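(* For integers $j,k\ge 0$ let $g_{j,k}$ be the number of simple involutions $\pi$ of length $n=j+k\ge 3$ that avoid the pattern $4321$ and have exactly $k$ fixed points (hence $j/2$ transpositions). Then $$\gamma(x,y):=\sum_{j,k} g_{j,k}\,x^{j}y^{k} = \frac12\left(\frac{1}{1+y}-2x^{2}(1+y)-\sqrt{-4+\frac{4}{1+x^{2}}+\frac{1}{(1+y)^{2}}}\right).$$
   Context: A permutation $\pi\in S_n$ avoids a pattern $s\in S_k$ if no subsequence of $\pi$ is order-isomorphic to $s$. An involution is a permutation equal to its own inverse; a fixed point is an $i$ with $\pi(i)=i$. An interval of $\pi\in S_n$ is a set of contiguous positions $[a,b]$ whose image $\{\pi(i):a\le i\le b\}$ is a set of contiguous integers; $\pi$ is simple if its only intervals are the empty set, singletons and $[1,n]$. The square root is the power series branch with constant term $\frac{1}{1+y}$ at $x=0$, i.e. the identity is one of formal power series in $x,y$. *)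

theory Defs
  imports
    "HOL-Computational_Algebra.Formal_Power_Series"
    "HOL-Combinatorics.Permutations"
begin

text \<open>
  An element of \<open>S\<^sub>n\<close> is a function \<open>p\<close> with \<open>p permutes {1..n}\<close>; outside \<open>{1..n}\<close> it is
  the identity, so distinct functions are distinct permutations of length \<open>n\<close>.
  Patterns are given in one-line notation, as lists.
\<close>

definition contains_pattern :: "nat \<Rightarrow> (nat \<Rightarrow> nat) \<Rightarrow> nat list \<Rightarrow> bool" where
  "contains_pattern n p s \<longleftrightarrow>
     (\<exists>f :: nat \<Rightarrow> nat. strict_mono_on {..<length s} f \<and> f ` {..<length s} \<subseteq> {1..n} \<and>
        (\<forall>a<length s. \<forall>b<length s. p (f a) < p (f b) \<longleftrightarrow> s ! a < s ! b))"

definition avoids_pattern :: "nat \<Rightarrow> (nat \<Rightarrow> nat) \<Rightarrow> nat list \<Rightarrow> bool" where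
  "avoids_pattern n p s \<longleftrightarrow> \<not> contains_pattern n p s"

definition is_involution :: "nat \<Rightarrow> (nat \<Rightarrow> nat) \<Rightarrow> bool" where
  "is_involution n p \<longleftrightarrow> p permutes {1..n} \<and> inv p = p"

definition fixed_points :: "nat \<Rightarrow> (nat \<Rightarrow> nat) \<Rightarrow> nat set" where
  "fixed_points n p = {i \<in> {1..n}. p i = i}"

text \<open>The empty interval arises from \<open>a > b\<close> (with \<open>c > d\<close>).\<close>

definition perm_interval :: "nat \<Rightarrow> (nat \<Rightarrow> nat) \<Rightarrow> nat set \<Rightarrow> bool" where
  "perm_interval n p I \<longleftrightarrow>
     I \<subseteq> {1..n} \<and> (\<exists>a b. I = {a..b}) \<and> (\<exists>c d. p ` I = {c..d})"

definition simple_perm :: "nat \<Rightarrow> (nat \<Rightarrow> nat) \<Rightarrow> bool" where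
  "simple_perm n p \<longleftrightarrow>
     (\<forall>I. perm_interval n p I \<longrightarrow> I = {} \<or> is_singleton I \<or> I = {1..n})"

text \<open>The length is \<open>j + k\<close>; lengths below 3 do not contribute.\<close>

definition g :: "nat \<Rightarrow> nat \<Rightarrow> nat" where
  "g j k = (if j + k \<ge> 3 then
      card {p. is_involution (j + k) p \<and> simple_perm (j + k) p \<and>
               avoids_pattern (j + k) p [4, 3, 2, 1] \<and> card (fixed_points (j + k) p) = k}
    else 0)"

text \<open>
  Formal power series in \<open>x\<close>, \<open>y\<close> over the rationals are represented as power series in \<open>x\<close>
  whose coefficients are power series in \<open>y\<close>.
\<close>

abbreviation X :: "rat fps fps" where "X \<equiv> fps_X"

abbreviation Y :: "rat fps fps" where "Y \<equiv> fps_const fps_X"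

abbreviation half :: "rat fps fps" where "half \<equiv> fps_const (fps_const (1 / 2))"

definition \<gamma> :: "rat fps fps" where
  "\<gamma> = Abs_fps (\<lambda>j. Abs_fps (\<lambda>k. of_nat (g j k)))"

text \<open>
  The coefficient ring \<^typ>\<open>rat fps\<close> is not a field, so the library does not provide that
  \<^const>\<open>inverse\<close> on \<^typ>\<open>rat fps fps\<close> is the multiplicative inverse. It is one for the
  series that occur as denominators.
\<close>

lemma fps_fps_inverse:
  fixes f :: "rat fps fps"
  assumes "fps_nth (fps_nth f 0) 0 \<noteq> 0"
  shows "inverse f * f = 1"
proof -
  let ?c = "inverse (fps_nth f 0)"
  have "?c * fps_nth f 0 = 1" "fps_nth f 0 * ?c = 1"
    using assms by (rule inverse_mult_eq_1 inverse_mult_eq_1')+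
  then show ?thesis
    unfolding fps_inverse_def[of f] by (rule fps_left_inverse')
qed

lemma inverse_denominators:
  "inverse (1 + X ^ 2) * (1 + X ^ 2) = 1"
  "inverse (1 + Y) * (1 + Y) = 1"
  "inverse ((1 + Y) ^ 2) * (1 + Y) ^ 2 = 1"
  by (rule fps_fps_inverse; simp add: power2_eq_square)+

text \<open>
  Likewise \<^const>\<open>fps_radical\<close> requires coefficients in a field. A branch of the square root
  is instead singled out by its constant term with respect to \<open>x\<close>.
\<close>

definition is_fps_sqrt :: "'a::idom fps \<Rightarrow> 'a \<Rightarrow> 'a fps \<Rightarrow> bool" where
  "is_fps_sqrt f c s \<longleftrightarrow> s ^ 2 = f \<and> fps_nth s 0 = c"

lemma is_fps_sqrt_unique:
  fixes s t :: "rat fps fps"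
  assumes "is_fps_sqrt f c s" "is_fps_sqrt f c t" "c \<noteq> 0"
  shows "s = t"
proof -
  have "s = t \<or> s = - t"
    using assms unfolding is_fps_sqrt_def by (metis power2_eq_iff)
  moreover have "s \<noteq> - t"
  proof
    assume "s = - t"
    then have "c = - c" using assms unfolding is_fps_sqrt_def by (metis fps_neg_nth)
    then have "fps_nth c n = 0" for n by (metis fps_neg_nth equal_neg_zero)
    then show False using assms(3) by (simp add: fps_eq_iff)
  qed
  ultimately show ?thesis by blast
qed

end

theory Submission
  imports Defs "HOL-Library.Infinite_Set"
begin

text \<open>
  An involution avoids 4321 iff no two of its arcs (transpositions) are nested. Such an involution
  is determined by the word that records which positions are left ends, right ends and fixed points,
  since the arcs are closed in the order in which they are opened. For length at least 3 it is
  simple iff the word has no proper prefix in which all arcs are closed, no two adjacent fixed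
  points, no two arcs with adjacent left ends and adjacent right ends, and is not the word of 321.

  Without the condition on adjacent arcs, the words are the Dyck paths of semilength \<open>m\<close> that return
  to 0 only at the end, with at most one fixed point in each of the \<open>2m - 1\<close> inner gaps; their series
  satisfies \<open>G = (1 + y) (G\<^sup>2 + w)\<close> with \<open>w = x\<^sup>2\<close>. Each of them arises uniquely from a word with
  the condition by replacing every arc by a nonempty bundle of parallel arcs, which substitutes
  \<open>w / (1 - w)\<close> for \<open>w\<close>. So the words with the condition have a series \<open>F\<close> with
  \<open>F = (1 + y) (F\<^sup>2 + w / (1 + w))\<close>, and \<open>\<gamma> = F - w (1 + y)\<close> because the words of 21 and 321
  are to be left out.
\<close>

unbundle fps_syntax

section \<open>Words and duplication of arcs\<close>

datatype step = Op | Cl | Fx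

lemma UNIV_step: "UNIV = {Op, Cl, Fx}"
  using step.exhaust by auto

instance step :: finite
  by standard (simp add: UNIV_step)

text \<open>
  \<open>h\<close> is the number of arcs that are open before the word is read. That it is positive before
  every letter says that no proper prefix of an admissible word is closed.
\<close>

fun good :: "nat \<Rightarrow> step list \<Rightarrow> bool" where
  "good h [] \<longleftrightarrow> h = 0"
| "good h (Op # v) \<longleftrightarrow> h > 0 \<and> good (Suc h) v"
| "good h (Cl # v) \<longleftrightarrow> h > 0 \<and> good (h - 1) v"
| "good h (Fx # v) \<longleftrightarrow> h > 0 \<and> good h v \<and> (\<forall>u. v \<noteq> Fx # u)"

fun admissible :: "step list \<Rightarrow> bool" where
  "admissible (Op # v) \<longleftrightarrow> good 1 v"
| "admissible _ \<longleftrightarrow> False"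

fun repeats :: "step \<Rightarrow> nat \<Rightarrow> step list \<Rightarrow> bool" where
  "repeats a i [] \<longleftrightarrow> False"
| "repeats a i (x # w) \<longleftrightarrow>
     (if x = a then (case i of 0 \<Rightarrow> (\<exists>u. w = a # u) | Suc j \<Rightarrow> repeats a j w) else repeats a i w)"

text \<open>If at most \<open>i\<close> letters \<open>a\<close> occur, the word is returned
  unchanged; hence the hypotheses \<open>i < count_list w a\<close> below. The copy stands next to
  the original, so the first letter never changes.\<close>

fun dup :: "step \<Rightarrow> nat \<Rightarrow> step list \<Rightarrow> step list" where
  "dup a i [] = []"
| "dup a i (x # w) =
     (if x = a then (case i of 0 \<Rightarrow> a # a # w | Suc j \<Rightarrow> a # dup a j w) else x # dup a i w)"

text \<open>
  In the first-in-first-out matching the \<open>i\<close>-th \<^const>\<open>Op\<close> (counted from 0) is joined to the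
  \<open>i\<close>-th \<^const>\<open>Cl\<close>, so \<open>parallel i w\<close> says that the arcs \<open>i\<close> and \<open>i + 1\<close> have adjacent left ends
  and adjacent right ends.
\<close>

definition parallel :: "nat \<Rightarrow> step list \<Rightarrow> bool" where
  "parallel i w \<longleftrightarrow> repeats Op i w \<and> repeats Cl i w"

definition dup_arc :: "nat \<Rightarrow> step list \<Rightarrow> step list" where
  "dup_arc i w = dup Cl i (dup Op i w)"

section \<open>Effect of duplication on words\<close>

lemma dup_eq_Cons_iff: "(\<exists>u. dup b i w = a # u) \<longleftrightarrow> (\<exists>u. w = a # u)"
  by (cases w) (auto split: nat.splits)

lemma dup_neq_Cons_iff: "(\<forall>u. dup b i w \<noteq> a # u) \<longleftrightarrow> (\<forall>u. w \<noteq> a # u)"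
  using dup_eq_Cons_iff[of b i w a] by blast

lemma repeats_dup_other: "a \<noteq> b \<Longrightarrow> repeats a i (dup b j w) = repeats a i w"
  by (induction b j w arbitrary: i rule: dup.induct)
     (auto split: nat.splits simp: dup_eq_Cons_iff)

lemma repeats_dup_less: "i < j \<Longrightarrow> repeats a i (dup a j w) = repeats a i w"
  by (induction a j w arbitrary: i rule: dup.induct)
     (auto split: nat.splits simp: dup_eq_Cons_iff)

lemma repeats_dup_same: "i < count_list w a \<Longrightarrow> repeats a i (dup a i w)"
  by (induction a i w rule: dup.induct) (auto split: nat.splits)

lemma repeats_imp_dup: "repeats a i w \<Longrightarrow> \<exists>w'. w = dup a i w' \<and> i < count_list w' a"
proof (induction a i w rule: repeats.induct)
  case (1 a i)
  then show ?case by simp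
next
  case (2 a i x w)
  show ?case
  proof (cases "x = a")
    case [simp]: True
    show ?thesis
    proof (cases i)
      case 0
      with 2(3) obtain u where u: "w = a # u" by auto
      show ?thesis by (rule exI[of _ "a # u"]) (simp add: 0 u)
    next
      case (Suc j)
      with 2(1)[of j] 2(3) obtain w' where "w = dup a j w'" "j < count_list w' a" by auto
      then show ?thesis by (intro exI[of _ "a # w'"]) (simp add: Suc)
    qed
  next
    case False
    with 2(2) 2(3) obtain w' where "w = dup a i w'" "i < count_list w' a" by auto
    then show ?thesis using False by (intro exI[of _ "x # w'"]) simp
  qed
qed

lemma dup_inject:
  "dup a i w = dup a i w' \<Longrightarrow> i < count_list w a \<Longrightarrow> i < count_list w' a \<Longrightarrow> w = w'"
proof (induction a i w arbitrary: w' rule: dup.induct)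
  case (1 a i)
  then show ?case by simp
next
  case (2 a i x w)
  then obtain y v where w': "w' = y # v" by (cases w') auto
  show ?case using 2 unfolding w' by (auto split: if_splits nat.splits)
qed

lemma count_dup_same: "i < count_list w a \<Longrightarrow> count_list (dup a i w) a = Suc (count_list w a)"
  by (induction a i w rule: dup.induct) (auto split: nat.splits)

lemma count_dup_other: "a \<noteq> b \<Longrightarrow> count_list (dup b i w) a = count_list w a"
  by (induction b i w rule: dup.induct) (auto split: nat.splits)

text \<open>The situation after the left end of the duplicated arc has been read: one more arc is open.\<close>

lemma good_dup_Cl: "s < h \<Longrightarrow> good (Suc h) (dup Cl s w) \<longleftrightarrow> good h w"
proof (induction w arbitrary: s h)
  case (Cons x w)
  show ?case
  proof (cases x)
    \<comment> \<open>Before the \<open>s\<close>-th \<open>Cl\<close> at least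
      \<open>h - s > 0\<close> of the original arcs are open, so deleting the additional arc leaves
      the height positive.\<close>
    case Cl
    with Cons.prems Cons.IH[of "s - 1" "h - 1"] show ?thesis
      by (cases s) auto
  qed (use Cons in \<open>simp_all add: dup_neq_Cons_iff\<close>)
qed auto

text \<open>The \<open>h\<close> arcs already open are closed first, so the \<open>i\<close>-th
  \<open>Op\<close> still to come belongs to the \<open>i + h\<close>-th \<open>Cl\<close>. Reading
  a \<open>Cl\<close> lowers both \<open>h\<close> and this index by one.\<close>

lemma good_dup_arc: "i < count_list w Op \<Longrightarrow> good h (dup Cl (i + h) (dup Op i w)) \<longleftrightarrow> good h w"
proof (induction w arbitrary: i h)
  case (Cons x w)
  show ?case
  proof (cases x)
    case [simp]: Op
    show ?thesis
    proof (cases i)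
      case 0
      then show ?thesis by (auto simp: good_dup_Cl)
    next
      case (Suc j)
      then show ?thesis using Cons.IH[of j "Suc h"] Cons.prems by auto
    qed
  next
    case Cl
    then show ?thesis using Cons.IH[of i "h - 1"] Cons.prems
      by (cases h) (auto split: nat.splits)
  next
    case Fx
    then show ?thesis using Cons.IH[of i h] Cons.prems
      by (simp add: dup_neq_Cons_iff)
  qed
qed auto

lemma admissible_dup_arc:
  assumes "i < count_list w Op"
  shows "admissible (dup_arc i w) \<longleftrightarrow> admissible w"
proof (cases w)
  case (Cons x v)
  then show ?thesis
  proof (cases x)
    case [simp]: Op
    \<comment> \<open>The leading \<open>Op\<close> is read by \<open>admissible\<close>. For
      \<open>i = 0\<close> its copy is the next letter and \<open>good_dup_Cl\<close> applies;
      otherwise the index drops by one and one arc is open.\<close>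
    show ?thesis using assms good_dup_Cl[of 0 1 v] good_dup_arc[of "i - 1" v 1]
      by (cases i) (auto simp: dup_arc_def Cons)
  qed (auto simp: dup_arc_def split: nat.splits)
qed (simp add: dup_arc_def)

lemma length_step_list: "length w = count_list w Op + count_list w Cl + count_list w Fx"
proof (induction w)
  case (Cons x w)
  then show ?case by (cases x) auto
qed simp

section \<open>Counting words by arcs, fixed points and parallel pairs\<close>

lemma good_counts: "good h w \<Longrightarrow> count_list w Cl = count_list w Op + h"
  by (induction h w rule: good.induct) auto

lemma admissible_counts: "admissible w \<Longrightarrow> count_list w Cl = count_list w Op"
  by (induction w rule: admissible.induct) (auto dest: good_counts)

text \<open>The threshold \<open>t\<close> leads from all admissible words (\<open>t = 0\<close>) to
  those without parallel arcs (\<open>t = m\<close>), so that bundles can be contracted one index at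
  a time.\<close>

definition words :: "nat \<Rightarrow> nat \<Rightarrow> nat \<Rightarrow> step list set" where
  "words t m k = {w. admissible w \<and> count_list w Op = m \<and> count_list w Fx = k \<and> (\<forall>i<t. \<not> parallel i w)}"

lemma finite_step_lists: "finite {w :: step list. length w = n}"
  using finite_lists_length_eq[of "UNIV :: step set" n] by simp

lemma finite_words: "finite (words t m k)"
proof (rule finite_subset)
  show "words t m k \<subseteq> {w. length w = m + m + k}"
    by (auto simp: words_def length_step_list admissible_counts)
qed (rule finite_step_lists)

text \<open>Doubling arc \<open>t\<close> creates the parallel pair \<open>t\<close>,
  \<open>t + 1\<close> and does not disturb the pairs below \<open>t\<close>; conversely, one arc of
  such a pair can be deleted.\<close>

lemma dup_arc_image:
  assumes "t < m"
  shows "dup_arc t ` words t m k = {w \<in> words t (Suc m) k. parallel t w}"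
proof (intro equalityI subsetI)
  fix w assume "w \<in> dup_arc t ` words t m k"
  then obtain w' where w: "w = dup_arc t w'" and w': "w' \<in> words t m k" by auto
  have c: "t < count_list w' Op" "t < count_list w' Cl"
    using w' assms by (auto simp: words_def admissible_counts)
  have "repeats Op t w" "repeats Cl t w"
    using c by (auto simp: w dup_arc_def repeats_dup_other repeats_dup_same count_dup_other)
  moreover have "parallel i w \<longleftrightarrow> parallel i w'" if "i < t" for i
    using that by (auto simp: w dup_arc_def parallel_def repeats_dup_other repeats_dup_less)
  moreover have "count_list w Op = Suc (count_list w' Op)" "count_list w Fx = count_list w' Fx"
    using c by (simp_all add: w dup_arc_def count_dup_other count_dup_same)
  moreover have "admissible w" using w' c admissible_dup_arc[of t w'] by (simp add: w words_def)
  ultimately show "w \<in> {w \<in> words t (Suc m) k. parallel t w}"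
    using w' by (simp add: words_def parallel_def[of t])
next
  fix w assume w: "w \<in> {w \<in> words t (Suc m) k. parallel t w}"
  then have "repeats Cl t w" "repeats Op t w" by (auto simp: parallel_def)
  then obtain v where v: "w = dup Cl t v" "t < count_list v Cl"
    using repeats_imp_dup by blast
  with \<open>repeats Op t w\<close> have "repeats Op t v" by (simp add: repeats_dup_other)
  then obtain w' where w': "v = dup Op t w'" "t < count_list w' Op"
    using repeats_imp_dup by blast
  have eq: "w = dup_arc t w'" by (simp add: v w' dup_arc_def)
  have "parallel i w \<longleftrightarrow> parallel i w'" if "i < t" for i
    using that by (auto simp: eq dup_arc_def parallel_def repeats_dup_other repeats_dup_less)
  moreover have "count_list w Op = Suc (count_list w' Op)" "count_list w Fx = count_list w' Fx"
    using w'(2) by (simp_all add: v(1) w'(1) count_dup_other count_dup_same)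
  moreover have "admissible w'" using w w'(2) admissible_dup_arc[of t w'] by (simp add: eq words_def)
  ultimately have "w' \<in> words t m k"
    using w by (simp add: words_def)
  then show "w \<in> dup_arc t ` words t m k" using eq by blast
qed

lemma dup_arc_inj:
  assumes "t < m"
  shows "inj_on (dup_arc t) (words t m k)"
proof (rule inj_onI)
  fix v w assume vw: "v \<in> words t m k" "w \<in> words t m k" "dup_arc t v = dup_arc t w"
  have "t < count_list v Op" "t < count_list v Cl" "t < count_list w Op" "t < count_list w Cl"
    using vw assms by (auto simp: words_def admissible_counts)
  moreover from this have "dup Op t v = dup Op t w"
    using vw(3) dup_inject[of Cl t "dup Op t v" "dup Op t w"] by (simp add: dup_arc_def count_dup_other)
  ultimately show "v = w" using dup_inject by blast
qed

lemma card_words_rec: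
  assumes "t < m"
  shows "card (words t (Suc m) k) = card (words (Suc t) (Suc m) k) + card (words t m k)"
proof -
  have "words t (Suc m) k = words (Suc t) (Suc m) k \<union> {w \<in> words t (Suc m) k. parallel t w}"
    by (auto simp: words_def less_Suc_eq)
  moreover have "words (Suc t) (Suc m) k \<inter> {w \<in> words t (Suc m) k. parallel t w} = {}"
    by (auto simp: words_def)
  ultimately have "card (words t (Suc m) k) = card (words (Suc t) (Suc m) k) + card (dup_arc t ` words t m k)"
    unfolding dup_arc_image[OF assms] by (metis (no_types, lifting) card_Un_disjoint finite_Un finite_words)
  then show ?thesis by (simp add: card_image dup_arc_inj assms)
qed

lemma repeats_imp_less_count: "repeats a i w \<Longrightarrow> Suc i < count_list w a"
  by (induction a i w rule: repeats.induct) (auto split: if_splits nat.splits)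

text \<open>A parallel pair \<open>i\<close>, \<open>i + 1\<close> requires
  \<open>i + 1 < m\<close>, so all thresholds from \<open>m - 1\<close> on give the same
  words.\<close>

lemma words_saturated:
  assumes "m \<le> Suc t"
  shows "words t m k = words m m k"
proof -
  have "i < t \<and> i < m" if "parallel i w" "count_list w Op = m" for i w
    using that assms repeats_imp_less_count[of Op i w] by (simp add: parallel_def)
  then show ?thesis unfolding words_def by (intro Collect_cong) metis
qed

text \<open>The coefficient counts the compositions of \<open>d + 1\<close> into
  \<open>j + 1\<close> parts: the arcs from \<open>t\<close> on are grouped into
  \<open>j + 1\<close> bundles, and contracting these leaves \<open>t + j + 1\<close> arcs. The
  proof iterates \<open>card_words_rec\<close> by Pascal's rule.\<close>

lemma card_words_binomial:
  "card (words t (Suc (t + d)) k) = (\<Sum>j\<le>d. (d choose j) * card (words (Suc (t + j)) (Suc (t + j)) k))"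
proof (induction d arbitrary: t)
  case 0
  show ?case using words_saturated[of "Suc t" t k] by simp
next
  case (Suc d)
  let ?B = "\<lambda>j. card (words (Suc (t + j)) (Suc (t + j)) k)"
  have "card (words t (Suc (t + Suc d)) k) =
      card (words (Suc t) (Suc (Suc t + d)) k) + card (words t (Suc (t + d)) k)"
    using card_words_rec[of t "Suc (t + d)" k] by simp
  also have "\<dots> = (\<Sum>j\<le>d. (d choose j) * ?B (Suc j)) + (\<Sum>j\<le>d. (d choose j) * ?B j)"
    using Suc.IH[of "Suc t"] Suc.IH[of t] by simp
  also have "(\<Sum>j\<le>d. (d choose j) * ?B j) = (\<Sum>j\<le>Suc d. (d choose j) * ?B j)"
    by simp
  also have "\<dots> = ?B 0 + (\<Sum>j\<le>d. (d choose Suc j) * ?B (Suc j))"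
    by (subst sum.atMost_Suc_shift) simp
  also have "(\<Sum>j\<le>d. (d choose j) * ?B (Suc j)) + \<dots> = ?B 0 + (\<Sum>j\<le>d. (Suc d choose Suc j) * ?B (Suc j))"
    by (simp add: sum.distrib[symmetric] algebra_simps)
  also have "\<dots> = (\<Sum>j\<le>Suc d. (Suc d choose j) * ?B j)"
    by (simp add: sum.atMost_Suc_shift del: sum.atMost_Suc binomial_Suc_Suc)
  finally show ?case .
qed

section \<open>Generating functions\<close>


text \<open>
  With \<^const>\<open>Fx\<close> merged into the following letter, a good word is a first passage from height \<open>h\<close>
  to 0, each step of which has weight \<open>x (1 + y)\<close>.
\<close>

definition passages :: "nat \<Rightarrow> nat \<Rightarrow> nat \<Rightarrow> step list set" where
  "passages h n k = {v. good h v \<and> count_list v Op + count_list v Cl = n \<and> count_list v Fx = k}"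

lemma finite_passages: "finite (passages h n k)"
proof (rule finite_subset)
  show "passages h n k \<subseteq> {w. length w = n + k}"
    by (auto simp: passages_def length_step_list)
qed (rule finite_step_lists)

lemma good_0_iff: "good 0 v \<longleftrightarrow> v = []"
  by (induction "0::nat" v rule: good.induct) auto

lemma passages_0: "passages 0 n k = (if n = 0 \<and> k = 0 then {[]} else {})"
  by (auto simp: passages_def good_0_iff)

lemma passages_Suc_0: "passages (Suc h) 0 k = {}"
  by (auto simp: passages_def dest: good_counts)

text \<open>Above height 0 a good word cannot stop and cannot have two adjacent \<open>Fx\<close>,
  so it begins with at most one \<open>Fx\<close> followed by an \<open>Op\<close> or a
  \<open>Cl\<close>.\<close>

lemma passages_Suc_Suc:
  "passages (Suc h) (Suc n) k =
     (Cons Op ` passages (Suc (Suc h)) n k \<union> Cons Cl ` passages h n k) \<union>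
     {v. k > 0 \<and> v \<in> Cons Fx ` (Cons Op ` passages (Suc (Suc h)) n (k - 1) \<union> Cons Cl ` passages h n (k - 1))}"
  (is "?L = ?R")
proof
  show "?L \<subseteq> ?R"
  proof
    fix v assume v: "v \<in> ?L"
    show "v \<in> ?R"
    proof (cases v)
      case Nil
      with v show ?thesis by (simp add: passages_def)
    next
      case (Cons x u)
      show ?thesis
      proof (cases x)
        case Fx
        show ?thesis
        proof (cases u)
          case Nil
          with v Cons Fx show ?thesis by (simp add: passages_def)
        next
          case (Cons y u')
          with v Fx \<open>v = x # u\<close> show ?thesis by (cases y) (auto simp: passages_def)
        qed
      qed (use v Cons in \<open>auto simp: passages_def\<close>)
    qed
  qed
  show "?R \<subseteq> ?L" by (auto simp: passages_def)
qed

section \<open>Power series of first passages\<close>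

definition passage_series :: "nat \<Rightarrow> rat fps fps" where
  "passage_series h = Abs_fps (\<lambda>n. Abs_fps (\<lambda>k. of_nat (card (passages h n k))))"

lemma card_passages_Suc_Suc:
  "card (passages (Suc h) (Suc n) k) =
     (card (passages (Suc (Suc h)) n k) + card (passages h n k)) +
     (if k = 0 then 0 else card (passages (Suc (Suc h)) n (k - 1)) + card (passages h n (k - 1)))"
proof -
  have *: "card (Cons Op ` passages (Suc (Suc h)) n k \<union> Cons Cl ` passages h n k) =
      card (passages (Suc (Suc h)) n k) + card (passages h n k)" for k
    by (subst card_Un_disjoint) (auto simp: finite_passages card_image)
  show ?thesis unfolding passages_Suc_Suc
    by (subst card_Un_disjoint) (auto simp: finite_passages card_image *)
qed

lemma passage_series_0: "passage_series 0 = 1"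
  by (simp add: passage_series_def passages_0 fps_eq_iff)

lemma passage_series_Suc_nth_0: "passage_series (Suc h) $ 0 = 0"
  by (simp add: passage_series_def passages_Suc_0 fps_eq_iff)

lemma passage_series_Suc_nth_Suc:
  "passage_series (Suc h) $ Suc n =
     (1 + fps_X) * (passage_series (Suc (Suc h)) $ n + passage_series h $ n)"
  by (rule fps_ext)
     (simp add: passage_series_def card_passages_Suc_Suc fps_mult_fps_X_plus_1_nth del: fps_mult_nth_0)

lemma passage_series_Suc:
  "passage_series (Suc h) = X * ((1 + Y) * (passage_series (Suc (Suc h)) + passage_series h))"
proof (rule fps_ext)
  have Y: "1 + Y = fps_const (1 + fps_X)" by (simp flip: fps_const_add)
  show "passage_series (Suc h) $ n =
      (X * ((1 + Y) * (passage_series (Suc (Suc h)) + passage_series h))) $ n" for n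
    unfolding Y
    by (cases n) (simp_all add: passage_series_Suc_nth_0 passage_series_Suc_nth_Suc)
qed

text \<open>For fixed \<open>b\<close>, both sides solve the recursion in \<open>a\<close> with the same value at \<open>a = 0\<close>.\<close>

lemma passage_series_add: "passage_series (a + b) = passage_series a * passage_series b"
proof (rule fps_ext)
  fix n
  have Y: "1 + Y = fps_const (1 + fps_X)" by (simp flip: fps_const_add)
  show "passage_series (a + b) $ n = (passage_series a * passage_series b) $ n"
  \<comment> \<open>Induction on the degree: the recursion raises the height to
    \<open>Suc (Suc c)\<close> but lowers the degree by one, so \<open>a\<close> must be
    arbitrary.\<close>
  proof (induction n arbitrary: a)
    case 0
    then show ?case
      by (cases a) (simp_all add: passage_series_0 passage_series_Suc_nth_0)
  next
    case (Suc n)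
    show ?case
    proof (cases a)
      case 0
      then show ?thesis by (simp add: passage_series_0)
    next
      case (Suc c)
      have "passage_series (a + b) $ Suc n =
          (1 + fps_X) * (passage_series (Suc (Suc c) + b) $ n + passage_series (c + b) $ n)"
        by (simp add: Suc passage_series_Suc_nth_Suc)
      also have "\<dots> = (1 + fps_X) * (((passage_series (Suc (Suc c)) + passage_series c) * passage_series b) $ n)"
        by (simp only: Suc.IH distrib_right fps_add_nth)
      also have "\<dots> = (X * ((1 + Y) * ((passage_series (Suc (Suc c)) + passage_series c) * passage_series b))) $ Suc n"
        unfolding Y by (simp only: fps_X_mult_nth fps_mult_left_const_nth) simp
      also have "X * ((1 + Y) * ((passage_series (Suc (Suc c)) + passage_series c) * passage_series b)) =
          passage_series a * passage_series b"
        using passage_series_Suc[of c] by (simp only: Suc mult.assoc)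
      finally show ?thesis .
    qed
  qed
qed

lemma passage_series_1: "passage_series 1 = (1 + Y) * X * ((passage_series 1)\<^sup>2 + 1)"
proof -
  have "passage_series 1 = X * ((1 + Y) * (passage_series (1 + 1) + passage_series 0))"
    using passage_series_Suc[of 0] by simp
  also have "\<dots> = (1 + Y) * X * ((passage_series 1)\<^sup>2 + 1)"
    unfolding passage_series_add by (simp add: passage_series_0 power2_eq_square mult_ac)
  finally show ?thesis .
qed

section \<open>Series of words by number of arcs\<close>

definition word_series :: "(nat \<Rightarrow> nat) \<Rightarrow> rat fps fps" where
  "word_series t = Abs_fps (\<lambda>m. Abs_fps (\<lambda>k. of_nat (card (words (t m) m k))))"

lemma words_0: "words t 0 k = {}"
proof -
  have "count_list w Op \<noteq> 0" if "admissible w" for w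
    using that by (cases w rule: admissible.cases) auto
  then show ?thesis by (auto simp: words_def)
qed

text \<open>After the leading \<open>Op\<close>, \<open>m\<close> openings and \<open>m + 1\<close>
  closings remain.\<close>

lemma words_Suc: "words 0 (Suc m) k = Cons Op ` passages 1 (Suc (2 * m)) k"
proof (intro equalityI subsetI)
  fix w assume "w \<in> words 0 (Suc m) k"
  then show "w \<in> Cons Op ` passages 1 (Suc (2 * m)) k"
    by (cases w rule: admissible.cases) (auto simp: words_def passages_def dest: good_counts intro!: imageI)
next
  fix w assume "w \<in> Cons Op ` passages 1 (Suc (2 * m)) k"
  then show "w \<in> words 0 (Suc m) k" 
    by (auto simp: words_def passages_def dest: good_counts)
qed

lemma passages_1_even: "passages 1 (2 * m) k = {}"
proof -
  have "count_list v Op + count_list v Cl \<noteq> 2 * m" if "good 1 v" for v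
    using good_counts[OF that] by presburger
  then show ?thesis unfolding passages_def by blast
qed

lemma fps_compose_X_power_nth:
  assumes "d > 0"
  shows "(f oo fps_X ^ d) $ n = (if d dvd n then f $ (n div d) else (0 :: 'a :: idom))"
proof -
  have "(f oo fps_X ^ d) $ n = (\<Sum>i=0..n. if n = d * i then f $ i else 0)"
    unfolding fps_compose_nth
    by (intro sum.cong refl) (simp add: fps_X_power_nth flip: power_mult)
  also have "\<dots> = (\<Sum>i\<in>{i \<in> {0..n}. n = d * i}. f $ i)"
    by (subst sum.inter_filter) simp_all
  also have "{i \<in> {0..n}. n = d * i} = (if d dvd n then {n div d} else {})"
    using assms by auto
  finally show ?thesis by simp
qed

text \<open>In \<open>word_series\<close> the variable marks arcs; substituting
  \<open>X\<^sup>2\<close> makes it mark their end points, as in \<open>passage_series\<close>. The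
  factor \<open>X\<close> is the leading \<open>Op\<close>.\<close>

lemma all_words_series_compose: "word_series (\<lambda>_. 0) oo X\<^sup>2 = X * passage_series 1"
proof (rule fps_ext)
  fix n
  have "(if even n then card (words 0 (n div 2) k) else 0) =
      (if n = 0 then 0 else card (passages 1 (n - 1) k))" for k
  proof (cases n)
    case (Suc m)
    show ?thesis
    proof (cases "even m")
      case True
      then show ?thesis using Suc passages_1_even[of "m div 2"] by simp
    next
      case False
      then obtain q where q: "m = Suc (2 * q)" using oddE by fastforce
      show ?thesis by (simp add: Suc q words_Suc card_image)
    qed
  qed (simp add: words_0)
  then have *: "of_nat (if even n then card (words 0 (n div 2) k) else 0) =
      (of_nat (if n = 0 then 0 else card (passages 1 (n - 1) k)) :: rat)" for k
    by (rule arg_cong)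
  show "(word_series (\<lambda>_. 0) oo X\<^sup>2) $ n = (X * passage_series 1) $ n"
  proof (rule fps_ext)
    fix k
    have "(word_series (\<lambda>_. 0) oo X\<^sup>2) $ n $ k =
        of_nat (if even n then card (words 0 (n div 2) k) else 0)"
      unfolding fps_compose_X_power_nth[OF zero_less_numeral] by (simp add: word_series_def)
    also note *
    also have "of_nat (if n = 0 then 0 else card (passages 1 (n - 1) k)) = (X * passage_series 1) $ n $ k"
      unfolding fps_X_mult_nth by (simp add: passage_series_def)
    finally show "(word_series (\<lambda>_. 0) oo X\<^sup>2) $ n $ k = (X * passage_series 1) $ n $ k" .
  qed
qed

lemma fps_compose_X_power_inject:
  fixes f g :: "'a :: idom fps"
  assumes "f oo fps_X ^ n = g oo fps_X ^ n" "n > 0"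
  shows "f = g"
proof (rule fps_ext)
  fix i
  have "(f oo fps_X ^ n) $ (n * i) = (g oo fps_X ^ n) $ (n * i)" using assms by simp
  then show "f $ i = g $ i" using assms(2) by (simp add: fps_compose_X_power_nth)
qed

text \<open>After the substitution of \<open>X\<^sup>2\<close> this is the quadratic equation for
  \<open>passage_series 1\<close> multiplied by \<open>X\<close>; the substitution is
  injective.\<close>

lemma all_words_series:
  "word_series (\<lambda>_. 0) = (1 + Y) * ((word_series (\<lambda>_. 0))\<^sup>2 + X)" (is "?G = _")
proof (rule fps_compose_X_power_inject[of _ 2])
  have "?G oo X\<^sup>2 = X * ((1 + Y) * X * ((passage_series 1)\<^sup>2 + 1))"
    unfolding all_words_series_compose by (rule arg_cong[OF passage_series_1])
  also have "\<dots> = (1 + Y) * ((?G oo X\<^sup>2)\<^sup>2 + X\<^sup>2)"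
    unfolding all_words_series_compose by (simp add: power2_eq_square algebra_simps)
  also have "\<dots> = ((1 + Y) * (?G\<^sup>2 + X)) oo X\<^sup>2"
    by (simp add: fps_compose_mult_distrib fps_compose_add_distrib fps_compose_power)
  finally show "?G oo X\<^sup>2 = ((1 + Y) * (?G\<^sup>2 + X)) oo X\<^sup>2" .
qed simp

section \<open>Bundles of parallel arcs as a substitution\<close>

lemma fps_geometric_power_Suc_nth:
  fixes f :: "'a :: idom fps"
  assumes f: "f * (1 - fps_X) = fps_X"
  shows "f ^ Suc r $ m = (if m = 0 then 0 else of_nat ((m - 1) choose r))"
proof -
  \<comment> \<open>\<open>?H r\<close> is the series of compositions into \<open>r + 1\<close>
    positive parts. The case \<open>m = 0\<close> is separate, since \<open>0 - 1 = 0\<close> on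
    naturals would give the value 1 for \<open>r = 0\<close>.\<close>
  let ?H = "\<lambda>r. Abs_fps (\<lambda>m. if m = 0 then 0 else of_nat ((m - 1) choose r)) :: 'a fps"
  have ne: "1 - fps_X \<noteq> (0 :: 'a fps)"
  proof
    assume "1 - fps_X = (0 :: 'a fps)"
    then have "(1 - fps_X) $ 0 = (0 :: 'a fps) $ 0" by simp
    then show False by simp
  qed
  have H0: "?H 0 * (1 - fps_X) = fps_X"
  proof (rule fps_ext)
    show "(?H 0 * (1 - fps_X)) $ n = (fps_X :: 'a fps) $ n" for n
      unfolding right_diff_distrib fps_sub_nth mult_1_right fps_mult_fps_X_commute[symmetric] fps_X_mult_nth
      by (cases n) (simp_all add: fps_X_nth)
  qed
  have HS: "?H (Suc r) * (1 - fps_X) = fps_X * ?H r" for r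
  proof (rule fps_ext)
    show "(?H (Suc r) * (1 - fps_X)) $ n = (fps_X * ?H r) $ n" for n
    proof (cases n)
      case (Suc m)
      show ?thesis
        unfolding right_diff_distrib fps_sub_nth mult_1_right fps_mult_fps_X_commute[symmetric] fps_X_mult_nth
        by (cases m) (simp_all add: Suc)
    qed (simp add: right_diff_distrib)
  qed
  have "f ^ Suc r = ?H r"
  proof (induction r)
    case 0
    have "f * (1 - fps_X) = ?H 0 * (1 - fps_X)" using f H0 by simp
    then have "f = ?H 0" using ne by (simp only: mult_cancel_right) auto
    then show ?case by (simp only: power_Suc0_right)
  next
    case (Suc r)
    have "f ^ Suc (Suc r) * (1 - fps_X) = (f * (1 - fps_X)) * f ^ Suc r"
      by (simp only: power_Suc mult_ac)
    also have "\<dots> = fps_X * f ^ Suc r" unfolding f ..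
    also have "\<dots> = ?H (Suc r) * (1 - fps_X)" unfolding Suc.IH HS ..
    finally show ?case using ne by (simp only: mult_cancel_right) auto
  qed
  then show ?thesis by simp
qed

text \<open>\<open>f\<close> is \<open>X / (1 - X)\<close>, the series of nonempty bundles. The
  coefficients of \<open>f ^ Suc j\<close> are the binomials of \<open>card_words_binomial\<close>
  at \<open>t = 0\<close>.\<close>

lemma all_words_series_eq_compose:
  assumes "f * (1 - X) = X"
  shows "word_series (\<lambda>_. 0) = word_series id oo f"
proof (rule fps_ext)
  fix n
  show "word_series (\<lambda>_. 0) $ n = (word_series id oo f) $ n"
  proof (cases n)
    case 0
    then show ?thesis by (simp add: fps_compose_nth word_series_def words_0)
  next
    case (Suc d)
    have "(word_series id oo f) $ n = (\<Sum>i\<le>Suc d. word_series id $ i * f ^ i $ Suc d)"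
      by (simp only: fps_compose_nth Suc atMost_atLeast0)
    \<comment> \<open>The term for \<open>i = 0\<close> vanishes because every admissible word has
      an arc.\<close>
    also have "\<dots> = (\<Sum>j\<le>d. word_series id $ Suc j * f ^ Suc j $ Suc d)"
      by (subst sum.atMost_Suc_shift) (simp add: word_series_def words_0)
    also have "\<dots> = (\<Sum>j\<le>d. word_series id $ Suc j * of_nat (d choose j))"
      by (simp only: fps_geometric_power_Suc_nth[OF assms]) simp
    also have "\<dots> = word_series (\<lambda>_. 0) $ n"
      using card_words_binomial[of 0 d]
      by (intro fps_ext)
         (simp add: word_series_def Suc fps_sum_nth fps_of_nat[symmetric] mult.commute del: fps_of_nat)
    finally show ?thesis ..
  qed
qed

text \<open>\<open>V\<close> is \<open>X / (1 + X)\<close>, the compositional inverse of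
  \<open>X / (1 - X)\<close>; composing with it undoes the replacement of arcs by bundles and
  carries over the equation for all words.\<close>

lemma reduced_words_series:
  assumes V: "V * (1 + X) = X"
  shows "word_series id = (1 + Y) * ((word_series id)\<^sup>2 + V)"
proof -
  define f :: "rat fps fps" where "f = X * inverse (1 - X)"
  have f: "f * (1 - X) = X"
    using fps_fps_inverse[of "1 - X"] by (simp add: f_def mult.assoc)
  have "V $ 0 = (V * (1 + X)) $ 0" by simp
  then have V0: "V $ 0 = 0" unfolding V by simp
  have f0: "f $ 0 = 0" by (simp add: f_def)
  have "(f oo V) * (1 - V) = V"
    using arg_cong[OF f, of "\<lambda>g. g oo V"] V0
    by (simp add: fps_compose_mult_distrib fps_compose_sub_distrib)
  then have "(f oo V) * ((1 + X) - V * (1 + X)) = V * (1 + X)"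
    by (metis (no_types, lifting) left_diff_distrib mult.assoc mult_1)
  then have fV: "f oo V = X" unfolding V by simp
  have "word_series id = word_series id oo (f oo V)" by (simp add: fV)
  also have "\<dots> = word_series (\<lambda>_. 0) oo V"
    unfolding fps_compose_assoc[OF V0 f0] all_words_series_eq_compose[OF f, symmetric] ..
  finally have G: "word_series id = word_series (\<lambda>_. 0) oo V" .
  have "((1 + Y) * ((word_series (\<lambda>_. 0))\<^sup>2 + X)) oo V = (1 + Y) * ((word_series id)\<^sup>2 + V)"
    unfolding G using V0
    by (simp add: fps_compose_mult_distrib fps_compose_add_distrib fps_compose_power)
  then show ?thesis unfolding all_words_series[symmetric] G .
qed

section \<open>The closed form\<close>

lemma reduced_words_series_X2:
  "(word_series id oo X\<^sup>2) = (1 + Y) * ((word_series id oo X\<^sup>2)\<^sup>2 + (1 - inverse (1 + X\<^sup>2)))"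
proof -
  define V :: "rat fps fps" where "V = 1 - inverse (1 + X)"
  have V: "V * (1 + X) = X"
    using fps_fps_inverse[of "1 + X"] by (simp add: V_def left_diff_distrib)
  have "(V oo X\<^sup>2) * (1 + X\<^sup>2) = X\<^sup>2"
    using arg_cong[OF V, of "\<lambda>g. g oo X\<^sup>2"]
    by (simp add: fps_compose_mult_distrib fps_compose_add_distrib)
  also have "X\<^sup>2 = (1 + X\<^sup>2) - 1" by simp
  finally have "(V oo X\<^sup>2) * (inverse (1 + X\<^sup>2) * (1 + X\<^sup>2)) = inverse (1 + X\<^sup>2) * (1 + X\<^sup>2) - inverse (1 + X\<^sup>2)"
    by (metis (no_types, lifting) mult.left_commute mult.right_neutral right_diff_distrib)
  then have V2: "V oo X\<^sup>2 = 1 - inverse (1 + X\<^sup>2)"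
    unfolding inverse_denominators by simp
  have X2: "X\<^sup>2 $ 0 = 0" by simp
  show ?thesis
    using arg_cong[OF reduced_words_series[OF V], of "\<lambda>g. g oo X\<^sup>2"]
    unfolding fps_compose_mult_distrib[OF X2] fps_compose_add_distrib fps_compose_power[OF X2, symmetric] V2
    by simp
qed


text \<open>Completing the square: with \<open>u = inverse (1 + Y)\<close> and
  \<open>v = 1 - inverse (1 + X\<^sup>2)\<close> the equation \<open>u * W = W\<^sup>2 + v\<close>
  gives \<open>(u - 2 * W)\<^sup>2 = u\<^sup>2 - 4 * v\<close>. In the hypothesis the added term,
  with series \<open>X\<^sup>2 * (1 + Y)\<close>, accounts for 21 and 321.\<close>

lemma gamma_closed_form:
  assumes g: "\<And>j k. g j k + (if j = 2 \<and> k \<le> 1 then 1 else 0) =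
      (if even j then card (words (j div 2) (j div 2) k) else 0)"
  shows "\<exists>s. is_fps_sqrt (- 4 + 4 * inverse (1 + X ^ 2) + inverse ((1 + Y) ^ 2))
               (inverse (1 + fps_X)) s \<and>
             \<gamma> = half * (inverse (1 + Y) - 2 * X ^ 2 * (1 + Y) - s)"
proof -
  let ?u = "inverse (1 + Y)"
  define W where "W = word_series id oo X\<^sup>2"
  have Y: "1 + Y = fps_const (1 + fps_X)" by (simp flip: fps_const_add)
  have gamma: "\<gamma> = W - X\<^sup>2 * (1 + Y)"
  proof -
    have "\<gamma> + X\<^sup>2 * (1 + Y) = W"
    proof (intro fps_ext)
      fix j k
      have "((X\<^sup>2 * (1 + Y)) $ j) $ k = (of_nat (if j = 2 \<and> k \<le> 1 then 1 else 0) :: rat)"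
        unfolding Y by (auto simp: fps_X_power_nth fps_X_nth)
      moreover have "(W $ j) $ k = of_nat (if even j then card (words (j div 2) (j div 2) k) else 0)"
        unfolding W_def fps_compose_X_power_nth[OF zero_less_numeral] by (simp add: word_series_def)
      ultimately show "((\<gamma> + X\<^sup>2 * (1 + Y)) $ j) $ k = (W $ j) $ k"
        unfolding g[symmetric] by (simp add: \<gamma>_def del: of_nat_add flip: of_nat_add)
    qed
    then show ?thesis by (simp add: eq_diff_eq)
  qed
  have W: "W = (1 + Y) * (W\<^sup>2 + (1 - inverse (1 + X\<^sup>2)))"
    unfolding W_def by (rule reduced_words_series_X2)
  have u: "?u * (1 + Y) = 1" by (rule inverse_denominators)
  have "?u * W = (?u * (1 + Y)) * (W\<^sup>2 + (1 - inverse (1 + X\<^sup>2)))"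
    by (subst W) (simp only: mult.assoc)
  then have uW: "?u * W = W\<^sup>2 + (1 - inverse (1 + X\<^sup>2))" unfolding u by simp
  have u2: "inverse ((1 + Y)\<^sup>2) = ?u\<^sup>2"
  proof -
    have "inverse ((1 + Y)\<^sup>2) * (1 + Y)\<^sup>2 = ?u\<^sup>2 * (1 + Y)\<^sup>2"
      unfolding inverse_denominators power_mult_distrib[symmetric] by simp
    moreover have "(1 + Y)\<^sup>2 \<noteq> 0" using u by auto
    ultimately show ?thesis by simp
  qed
  \<comment> \<open>No admissible word is without arcs; hence \<open>?u - 2 * W\<close> has the
    constant term that selects the required branch.\<close>
  have "W $ 0 = 0"
    unfolding W_def by (simp add: fps_eq_iff word_series_def words_0)
  then have "(?u - 2 * W) $ 0 = inverse (1 + fps_X)" by simp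
  moreover have "(?u - 2 * W)\<^sup>2 = ?u\<^sup>2 - 4 * (?u * W) + 4 * W\<^sup>2"
    by (simp add: power2_eq_square algebra_simps)
  then have "(?u - 2 * W)\<^sup>2 = - 4 + 4 * inverse (1 + X ^ 2) + inverse ((1 + Y) ^ 2)"
    unfolding uW u2 by (simp add: algebra_simps)
  moreover have half: "half * 2 = 1"
    by (simp add: fps_eq_iff numeral_fps_const flip: fps_const_mult)
  have "\<gamma> = (half * 2) * (W - X\<^sup>2 * (1 + Y))" unfolding half gamma by simp
  then have "\<gamma> = half * (?u - 2 * X ^ 2 * (1 + Y) - (?u - 2 * W))"
    by (simp add: algebra_simps)
  ultimately show ?thesis unfolding is_fps_sqrt_def by blast
qed

section \<open>Simple involutions with no nested arcs\<close>

text \<open>If \<open>p a \<le> a\<close>, the conclusion is automatic, so for an involution the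
  condition is about two arcs. Fixed points below an arc are allowed.\<close>

definition nonnesting :: "(nat \<Rightarrow> nat) \<Rightarrow> bool" where
  "nonnesting p \<longleftrightarrow> (\<forall>a b. a < b \<and> b < p b \<longrightarrow> p a < p b)"

lemma nonnestingD: "nonnesting p \<Longrightarrow> a < b \<Longrightarrow> b < p b \<Longrightarrow> p a < p b"
  by (simp add: nonnesting_def)

section \<open>Elementary facts on involutions\<close>

lemma involution_permutes: "is_involution n p \<Longrightarrow> p permutes {1..n}"
  by (simp add: is_involution_def)

lemma involution_involutive: "is_involution n p \<Longrightarrow> p (p i) = i"
  unfolding is_involution_def by (metis permutes_inverses(1))

lemma involution_eq_iff: "is_involution n p \<Longrightarrow> p i = p j \<longleftrightarrow> i = j"
  by (metis involution_involutive)

lemma involution_in_iff: "is_involution n p \<Longrightarrow> p i \<in> {1..n} \<longleftrightarrow> i \<in> {1..n}"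
  by (simp only: permutes_in_image[OF involution_permutes])

lemma involution_outside: "is_involution n p \<Longrightarrow> i \<notin> {1..n} \<Longrightarrow> p i = i"
  by (simp add: is_involution_def permutes_def)

lemma involutionI:
  assumes "\<And>i. p (p i) = i" "\<And>i. i \<notin> {1..n} \<Longrightarrow> p i = i"
  shows "is_involution n p"
proof -
  have "p permutes {1..n}" unfolding permutes_def using assms by metis
  moreover have "inv p = p" using assms(1) by (intro inv_equality)
  ultimately show ?thesis by (simp add: is_involution_def)
qed

section \<open>The pattern 4321 and nested arcs\<close>

lemma all_less_4_iff: "(\<forall>a<4. P a) \<longleftrightarrow> P 0 \<and> P 1 \<and> P 2 \<and> P (3 :: nat)"
  by (simp add: numeral_eq_Suc All_less_Suc2)

text \<open>The four end points of two nested arcs form 4321. Conversely, in a 4321 either the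
  second position is a left end, and then its arc lies inside the arc of the first, or the third is
  a right end, and then its arc lies inside that of the fourth.\<close>

lemma avoids_4321_iff_nonnesting:
  assumes p: "is_involution n p"
  shows "avoids_pattern n p [4, 3, 2, 1] \<longleftrightarrow> nonnesting p"
proof
  have len: "length [4, 3, 2, 1 :: nat] = 4" by simp
  assume av: "avoids_pattern n p [4, 3, 2, 1]"
  show "nonnesting p"
  proof (rule ccontr)
    assume "\<not> nonnesting p"
    then obtain a b where ab: "a < b" "b < p b" "\<not> p a < p b" unfolding nonnesting_def by blast
    then have "p b < p a" using involution_eq_iff[OF p, of a b] by linarith
    have in_range: "p a \<in> {1..n}" "p b \<in> {1..n}" "a \<in> {1..n}" "b \<in> {1..n}"
      using involution_outside[OF p, of a] involution_outside[OF p, of b]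
        involution_in_iff[OF p, of a] involution_in_iff[OF p, of b] ab \<open>p b < p a\<close> by force+
    let ?f = "\<lambda>i. [a, b, p b, p a] ! i"
    have "strict_mono_on {..<4} ?f"
      using ab \<open>p b < p a\<close> by (auto simp: strict_mono_on_def less_Suc_eq numeral_eq_Suc)
    moreover have "?f ` {..<4} \<subseteq> {1..n}"
      using in_range by (auto simp: less_Suc_eq numeral_eq_Suc)
    moreover have "\<forall>i<4. \<forall>j<4. p (?f i) < p (?f j) \<longleftrightarrow> [4, 3, 2, 1 :: nat] ! i < [4, 3, 2, 1] ! j"
      using ab \<open>p b < p a\<close> by (simp add: all_less_4_iff involution_involutive[OF p])
    ultimately have "contains_pattern n p [4, 3, 2, 1]"
      unfolding contains_pattern_def len by (intro exI[of _ ?f] conjI)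
    with av show False by (simp add: avoids_pattern_def)
  qed
next
  have len: "length [4, 3, 2, 1 :: nat] = 4" by simp
  assume nn: "nonnesting p"
  show "avoids_pattern n p [4, 3, 2, 1]"
    unfolding avoids_pattern_def
  proof
    assume "contains_pattern n p [4, 3, 2, 1]"
    then obtain f where f: "strict_mono_on {..<4} f"
      "\<forall>i<4. \<forall>j<4. p (f i) < p (f j) \<longleftrightarrow> [4, 3, 2, 1 :: nat] ! i < [4, 3, 2, 1] ! j"
      unfolding contains_pattern_def len by (elim exE conjE) (rule that)
    have lt: "f 0 < f 1" "f 1 < f 2" "f 2 < f 3"
      using f(1) by (auto simp: strict_mono_on_def)
    have gt: "p (f 1) < p (f 0)" "p (f 2) < p (f 1)" "p (f 3) < p (f 2)"
      using f(2) by (simp_all add: all_less_4_iff)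
    show False
    proof (cases "f 1 < p (f 1)")
      case True
      then show False using nonnestingD[OF nn lt(1)] gt by simp
    next
      case False
      then have "p (f 2) < p (p (f 2))" using lt gt by (simp add: involution_involutive[OF p])
      from nonnestingD[OF nn gt(3) this] show False using lt by (simp add: involution_involutive[OF p])
    qed
  qed
qed

section \<open>Intervals and simplicity\<close>

lemma involution_image_image: "is_involution n p \<Longrightarrow> p ` p ` S = S"
  by (simp add: image_comp comp_def involution_involutive)

lemma involution_image_eqI:
  assumes "is_involution n p" "p ` S \<subseteq> S"
  shows "p ` S = S"
  using assms involution_image_image[OF assms(1), of S] by (metis image_mono subset_antisym)

text \<open>A point left of \<open>a\<close> has its image outside \<open>{a..b}\<close>, and by the
  arc from \<open>x\<close> this image lies below \<open>p x\<close>, hence below \<open>a\<close>.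
  So \<open>{1..a - 1}\<close> is invariant, and indecomposability gives \<open>a = 1\<close> and
  then \<open>b = n\<close>.\<close>

lemma invariant_interval_full:
  assumes p: "is_involution n p" and nn: "nonnesting p"
    and indec: "\<forall>i. 0 < i \<and> i < n \<longrightarrow> p ` {1..i} \<noteq> {1..i}"
    and inv: "p ` {a..b} = {a..b}" and ab: "{a..b} \<subseteq> {1..n}"
    and x: "x \<in> {a..b}" "x < p x"
  shows "a = 1 \<and> b = n"
proof -
  have range: "1 \<le> a" "b \<le> n" "a \<le> b" using ab x(1) by auto
  have px: "p x \<le> b" using inv x(1) by auto
  have "p j < a" if j: "1 \<le> j" "j < a" for j
  proof (rule ccontr)
    assume "\<not> p j < a"
    moreover have "p j \<notin> {a..b}"
    proof
      assume "p j \<in> {a..b}"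
      then have "p (p j) \<in> {a..b}" using inv by blast
      then show False using j by (simp add: involution_involutive[OF p])
    qed
    moreover have "p j < p x" using nonnestingD[OF nn _ x(2), of j] j x(1) by simp
    ultimately show False using px by simp
  qed
  moreover have "1 \<le> p j" if "1 \<le> j" "j < a" for j
    using involution_in_iff[OF p, of j] that range by auto
  ultimately have sub: "p ` {1..a - 1} \<subseteq> {1..a - 1}"
    by (fastforce simp: image_subset_iff)
  have "p ` {1..a - 1} = {1..a - 1}" by (rule involution_image_eqI[OF p sub])
  then have "\<not> (0 < a - 1 \<and> a - 1 < n)" using indec[rule_format, of "a - 1"] by linarith
  then have a: "a = 1" using range by linarith
  have "b = n"
  proof (rule ccontr)
    assume "b \<noteq> n"
    then have "0 < b \<and> b < n" using range by simp
    from indec[rule_format, OF this] show False using inv a by simp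
  qed
  with a show ?thesis by simp
qed

text \<open>An interval \<open>{a..b}\<close> and its image \<open>{c..d}\<close> are exchanged by
  \<open>p\<close>, so the order \<open>a \<le> c\<close> can be arranged by swapping them. If they
  coincide, the interval is full or pointwise fixed; if they are shifted by at least two, there are
  parallel arcs; if by one, there are adjacent fixed points or the permutation is 321.\<close>

lemma no_proper_interval:
  assumes p: "is_involution n p" and nn: "nonnesting p"
    and indec: "\<forall>i. 0 < i \<and> i < n \<longrightarrow> p ` {1..i} \<noteq> {1..i}"
    and nofix: "\<forall>i. 0 < i \<and> i < n \<longrightarrow> p i \<noteq> i \<or> p (Suc i) \<noteq> Suc i"
    and nopar: "\<forall>i. i < p i \<longrightarrow> p (Suc i) \<noteq> Suc (p i)"
    and no321: "\<not> (n = 3 \<and> p 1 = 3 \<and> p 2 = 2)"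
    and I: "p ` {a..b} = {c..d}" "p ` {c..d} = {a..b}" and ab: "{a..b} \<subseteq> {1..n}" "{a..b} \<noteq> {1..n}"
    and "a < b" "a \<le> c" and d: "d = b + (c - a)"
  shows False
proof -
  have range: "1 \<le> a" "b \<le> n" using ab \<open>a < b\<close> by auto
  have pI: "p x \<in> {c..d}" if "x \<in> {a..b}" for x using that I by blast
  have pJ: "p x \<in> {a..b}" if "x \<in> {c..d}" for x using that I by blast
  show False
  proof (cases "a = c")
    case True
    then have bd: "b = d" using d by simp
    have "p x = x" if "x \<in> {a..b}" for x
    proof -
      have "\<not> y < p y" if "y \<in> {a..b}" for y
        using invariant_interval_full[OF p nn indec _ ab(1) that] I ab True bd by auto
      from this[of x] this[of "p x"] that pI[of x] show ?thesis
        using True bd by (simp add: involution_involutive[OF p])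
    qed
    then show False using nofix[rule_format, of a] range \<open>a < b\<close> by simp
  next
    case False
    then have "a < c" using \<open>a \<le> c\<close> by simp
    have out: "b < p x" if "a \<le> x" "x \<le> b" "x < c" for x
    proof (rule ccontr)
      assume "\<not> b < p x"
      then have "p x \<in> {a..b}" using pI[of x] that \<open>a < c\<close> by auto
      from pI[OF this] that show False by (simp add: involution_involutive[OF p])
    qed
    show False
    proof (cases "Suc a < c")
      case True
      have gt: "b < p a" "b < p (Suc a)" using out[of a] out[of "Suc a"] True \<open>a < b\<close> by auto
      then have lt: "p a < p (Suc a)" using nonnestingD[OF nn, of a "Suc a"] \<open>a < b\<close> by simp
      have "p (Suc a) \<noteq> Suc (p a)" using nopar[rule_format, of a] gt \<open>a < b\<close> by simp
      \<comment> \<open>\<open>z\<close> is the preimage of \<open>Suc (p a)\<close>. It lies right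
        of \<open>Suc a\<close>, so its arc would be nested in that of \<open>Suc a\<close>.\<close>
      moreover define z where "z = p (Suc (p a))"
      have pz: "p z = Suc (p a)" by (simp add: z_def involution_involutive[OF p])
      have "Suc (p a) \<in> {c..d}" using pI[of a] pI[of "Suc a"] lt \<open>a < b\<close> by auto
      then have z: "z \<in> {a..b}" unfolding z_def by (rule pJ)
      have "z \<noteq> a" using pz by auto
      moreover have "z \<noteq> Suc a" using pz \<open>p (Suc a) \<noteq> Suc (p a)\<close> by auto
      ultimately have "Suc a < z" using z by auto
      then have "p (Suc a) < p z" using nonnestingD[OF nn, of "Suc a" z] pz gt z by auto
      then show False using pz lt by simp
    next
      case False
      then have c: "c = Suc a" and d': "d = Suc b" using \<open>a < c\<close> d by auto
      have pa: "p a = Suc b" using out[of a] pI[of a] c d' \<open>a < b\<close> by auto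
      \<comment> \<open>An arc starting right of \<open>a\<close> and ending by \<open>b\<close>
        would be nested in the arc from \<open>a\<close> to \<open>Suc b\<close>.\<close>
      have le: "p x \<le> x \<and> a < p x \<and> p x \<le> b" if "a < x" "x \<le> b" for x
        using pI[of x] pJ[of x] nonnestingD[OF nn, of a x] that c d' pa by fastforce
      have fixed: "p x = x" if "a < x" "x \<le> b" for x
        using le[OF that] le[of "p x"] by (simp add: involution_involutive[OF p])
      have "\<not> Suc (Suc a) \<le> b"
        using nofix[rule_format, of "Suc a"] fixed[of "Suc a"] fixed[of "Suc (Suc a)"] range by auto
      then have b: "b = Suc a" using \<open>a < b\<close> by simp
      have un: "{a..Suc b} = {a..b} \<union> {c..d}" using c d' b by auto
      have "p ` {a..Suc b} = {a..Suc b}" unfolding un image_Un I by blast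
      moreover have "{a..Suc b} \<subseteq> {1..n}"
        using pa involution_in_iff[OF p, of a] range \<open>a < b\<close> by auto
      ultimately have "a = 1 \<and> Suc b = n"
        using invariant_interval_full[OF p nn indec, of a "Suc b" a] pa \<open>a < b\<close> by simp
      then show False using no321 b pa fixed[of 2] by simp
    qed
  qed
qed

lemma simple_perm_short_interval:
  assumes "simple_perm n p" "n \<ge> 3" "0 < i" "i < n" "p ` {i, Suc i} = {c, Suc c}"
  shows False
proof -
  have "{i, Suc i} = {i..Suc i}" "{c, Suc c} = {c..Suc c}" by auto
  then have "perm_interval n p {i, Suc i}"
    unfolding perm_interval_def using assms by auto
  then have "is_singleton {i, Suc i} \<or> {i, Suc i} = {1..n}"
    using assms(1) unfolding simple_perm_def by blast
  moreover have "card {i, Suc i} = 2" by simp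
  ultimately show False using assms(2) by (auto simp: is_singleton_altdef)
qed

text \<open>Each violated condition exhibits a proper interval of more than one point; conversely,
  \<open>no_proper_interval\<close> applies to an interval or to its image, whichever starts further
  left.\<close>

lemma simple_perm_iff:
  assumes p: "is_involution n p" and nn: "nonnesting p" and n: "n \<ge> 3"
  shows "simple_perm n p \<longleftrightarrow>
    (\<forall>i. 0 < i \<and> i < n \<longrightarrow> p ` {1..i} \<noteq> {1..i}) \<and>
    (\<forall>i. 0 < i \<and> i < n \<longrightarrow> p i \<noteq> i \<or> p (Suc i) \<noteq> Suc i) \<and>
    (\<forall>i. i < p i \<longrightarrow> p (Suc i) \<noteq> Suc (p i)) \<and>
    \<not> (n = 3 \<and> p 1 = 3 \<and> p 2 = 2)" (is "_ \<longleftrightarrow> ?R")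
proof
  assume s: "simple_perm n p"
  note short = simple_perm_short_interval[OF s n]
  have "p ` {1..i} \<noteq> {1..i}" if i: "0 < i" "i < n" for i
  proof
    assume inv: "p ` {1..i} = {1..i}"
    show False
    \<comment> \<open>For \<open>i = 1\<close> the prefix is a singleton, and the complement
      \<open>{2..n}\<close> is used, which has at least two points.\<close>
    proof (cases "i = 1")
      case True
      have "p ` {1..n} = {1..n}" using permutes_image[OF involution_permutes[OF p]] .
      moreover have "{2..n} = {1..n} - {1..i}" using True by auto
      moreover have "inj p" by (metis injI involution_eq_iff p)
      ultimately have "p ` {2..n} = {2..n}" using inv by (simp add: image_set_diff)
      then have "perm_interval n p {2..n}" unfolding perm_interval_def by auto
      then have "{2..n} = {} \<or> is_singleton {2..n} \<or> {2..n} = {1..n}"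
        using s unfolding simple_perm_def by blast
      moreover have "1 \<in> {1..n}" "1 \<notin> {2..n}" using n by auto
      ultimately show False using n by (auto simp: is_singleton_altdef)
    next
      case False
      have "perm_interval n p {1..i}" unfolding perm_interval_def using inv i by auto
      then have "{1..i} = {} \<or> is_singleton {1..i} \<or> {1..i} = {1..n}"
        using s unfolding simple_perm_def by blast
      then show False using i False by (auto simp: is_singleton_altdef)
    qed
  qed
  moreover have "p i \<noteq> i \<or> p (Suc i) \<noteq> Suc i" if "0 < i" "i < n" for i
    using short[OF that, of i] by auto
  moreover have "p (Suc i) \<noteq> Suc (p i)" if i: "i < p i" for i
  proof
    assume *: "p (Suc i) = Suc (p i)"
    have "i \<in> {1..n}" "Suc i \<in> {1..n}"
      using involution_outside[OF p, of i] involution_outside[OF p, of "Suc i"] i * by auto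
    then show False using short[of i "p i"] * by auto
  qed
  moreover have "\<not> (n = 3 \<and> p 1 = 3 \<and> p 2 = 2)"
  proof
    assume *: "n = 3 \<and> p 1 = 3 \<and> p 2 = 2"
    have "p ` {1, Suc 1} = {p 1, p 2}" by (simp add: numeral_2_eq_2)
    also have "\<dots> = {2, Suc 2}" using * by auto
    finally show False using short[of 1 2] * by linarith
  qed
  ultimately show ?R by blast
next
  assume R: ?R
  show "simple_perm n p"
    unfolding simple_perm_def
  proof (intro allI impI)
    fix I assume "perm_interval n p I"
    then obtain a b c d where I: "I = {a..b}" "p ` I = {c..d}" "I \<subseteq> {1..n}"
      unfolding perm_interval_def by blast
    show "I = {} \<or> is_singleton I \<or> I = {1..n}"
    proof (rule ccontr)
      assume "\<not> ?thesis"
      then have ne: "I \<noteq> {}" "\<not> is_singleton I" "I \<noteq> {1..n}" by auto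
      have ab: "a < b"
      proof (rule ccontr)
        assume "\<not> a < b"
        then have "b < a \<or> a = b" by auto
        with ne I(1) show False by (auto simp: is_singleton_altdef)
      qed
      have "inj p" by (metis injI involution_eq_iff p)
      then have "card (p ` I) = card I" by (intro card_image) (auto simp: inj_on_def)
      then have len: "Suc d - c = Suc b - a" using I by simp
      have J: "p ` {a..b} = {c..d}" "p ` {c..d} = {a..b}"
        using I involution_image_image[OF p, of I] by auto
      have J_sub: "{c..d} \<subseteq> {1..n}"
        using image_mono[OF I(3), of p] by (simp only: I(2) permutes_image[OF involution_permutes[OF p]])
      have J_neq: "{c..d} \<noteq> {1..n}"
        using J(2) permutes_image[OF involution_permutes[OF p]] ne(3) I(1) by metis
      have cd: "c < d" "a \<le> c \<Longrightarrow> d = b + (c - a)" "c \<le> a \<Longrightarrow> b = d + (a - c)"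
        using len ab by linarith+
      from R have "\<forall>i. 0 < i \<and> i < n \<longrightarrow> p ` {1..i} \<noteq> {1..i}"
        "\<forall>i. 0 < i \<and> i < n \<longrightarrow> p i \<noteq> i \<or> p (Suc i) \<noteq> Suc i"
        "\<forall>i. i < p i \<longrightarrow> p (Suc i) \<noteq> Suc (p i)"
        "\<not> (n = 3 \<and> p 1 = 3 \<and> p 2 = 2)"
        by blast+
      note core = no_proper_interval[OF p nn this]
      show False
      proof (cases "a \<le> c")
        case True
        show False
          by (rule core[OF J _ _ ab True cd(2)[OF True]]) (use I ne in blast)+
      next
        case False
        then have "c \<le> a" by simp
        show False
          by (rule core[OF J(2,1) J_sub _ cd(1) \<open>c \<le> a\<close> cd(3)[OF \<open>c \<le> a\<close>]]) (rule J_neq)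
      qed
    qed
  qed
qed

section \<open>The correspondence with words\<close>

lemma good_iff:
  "good h w \<longleftrightarrow>
    (\<forall>i<length w. count_list (take i w) Cl < count_list (take i w) Op + h) \<and>
    count_list w Cl = count_list w Op + h \<and> successively (\<lambda>a b. a \<noteq> Fx \<or> b \<noteq> Fx) w"
proof (induction h w rule: good.induct)
  case (1 h)
  then show ?case by simp
next
  case (2 h v)
  then show ?case by (cases v) (simp_all add: All_less_Suc2)
next
  case (3 h v)
  show ?case
  proof (cases h)
    case (Suc h')
    then show ?thesis using 3 by (cases v) (simp_all add: All_less_Suc2)
  qed (simp add: All_less_Suc2)
next
  case (4 h v)
  show ?case
  proof (cases v)
    case (Cons x u)
    then show ?thesis using 4 by (cases x) (simp_all add: All_less_Suc2)
  qed (simp add: All_less_Suc2)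
qed

text \<open>The length bound excludes \<open>[]\<close> and \<open>[Fx]\<close>, which satisfy the
  right-hand side but do not begin with an \<open>Op\<close>.\<close>

lemma admissible_iff:
  assumes "length w \<ge> 2"
  shows "admissible w \<longleftrightarrow>
    (\<forall>i. 0 < i \<and> i < length w \<longrightarrow> count_list (take i w) Cl < count_list (take i w) Op) \<and>
    count_list w Cl = count_list w Op \<and> successively (\<lambda>a b. a \<noteq> Fx \<or> b \<noteq> Fx) w"
proof (cases w)
  case (Cons x v)
  have all: "(\<forall>i. 0 < i \<and> i < length w \<longrightarrow> P i) \<longleftrightarrow> (\<forall>i<length v. P (Suc i))" for P
    unfolding Cons by (metis Suc_less_eq gr0_conv_Suc length_Cons zero_less_Suc)
  have v: "0 < length v" using assms by (cases v) (simp_all add: Cons)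
  show ?thesis
  proof (cases x)
    case Op
    then show ?thesis unfolding all by (auto simp: Cons good_iff successively_Cons)
  next
    case Cl
    then have "\<not> count_list (take (Suc 0) w) Cl < count_list (take (Suc 0) w) Op" by (simp add: Cons)
    then show ?thesis unfolding all using v by (auto simp: Cons Cl)
  next
    case Fx
    then have "\<not> count_list (take (Suc 0) w) Cl < count_list (take (Suc 0) w) Op" by (simp add: Cons)
    then show ?thesis unfolding all using v by (auto simp: Cons Fx)
  qed
qed (use assms in simp)

lemma count_list_take:
  "i \<le> length w \<Longrightarrow> count_list (take i w) a = card {j \<in> {1..i}. w ! (j - 1) = a}"
proof (induction i)
  case (Suc i)
  have "{j \<in> {1..Suc i}. w ! (j - 1) = a} =
      (if w ! i = a then insert (Suc i) {j \<in> {1..i}. w ! (j - 1) = a} else {j \<in> {1..i}. w ! (j - 1) = a})"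
    by (auto simp: le_Suc_eq)
  then show ?case using Suc by (simp add: take_Suc_conv_app_nth)
qed simp

lemma count_list_take_Suc:
  "i < length w \<Longrightarrow> count_list (take (Suc i) w) a = count_list (take i w) a + (if w ! i = a then 1 else 0)"
  by (simp add: take_Suc_conv_app_nth)

lemma count_list_take_mono: "i \<le> j \<Longrightarrow> count_list (take i w) a \<le> count_list (take j w) a"
  by (metis count_list_append le_Suc_ex le_add1 take_add)

lemma rank_inject:
  assumes "x < length w" "y < length w" "w ! x = a" "w ! y = a"
    and "count_list (take x w) a = count_list (take y w) a"
  shows "x = y"
proof -
  have "\<not> u < v" if "u < length w" "w ! u = a" "count_list (take u w) a = count_list (take v w) a" for u v
    using that count_list_take_mono[of "Suc u" v w a] by (auto simp: count_list_take_Suc)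
  from this[of x y] this[of y x] assms show ?thesis by simp
qed

lemma repeats_iff:
  "repeats a r w \<longleftrightarrow>
    (\<exists>i. Suc i < length w \<and> w ! i = a \<and> w ! Suc i = a \<and> count_list (take i w) a = r)"
proof (induction a r w rule: repeats.induct)
  case (2 a r x w)
  have ex: "(\<exists>i. P i) \<longleftrightarrow> P 0 \<or> (\<exists>i. P (Suc i))" for P :: "nat \<Rightarrow> bool"
    by (metis not0_implies_Suc)
  show ?case using 2 by (subst ex) (cases w; cases r; auto)
qed simp

section \<open>The word of an involution\<close>

definition word_of :: "nat \<Rightarrow> (nat \<Rightarrow> nat) \<Rightarrow> step list" where
  "word_of n p = map (\<lambda>i. if i < p i then Op else if p i < i then Cl else Fx) [1..<Suc n]"

lemma length_word_of [simp]: "length (word_of n p) = n"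
  by (simp add: word_of_def)

lemma nth_word_of:
  "i < n \<Longrightarrow> word_of n p ! i = (if Suc i < p (Suc i) then Op else if p (Suc i) < Suc i then Cl else Fx)"
  by (simp add: word_of_def del: upt_Suc)

lemma count_word_of:
  assumes "i \<le> n"
  shows "count_list (take i (word_of n p)) Op = card {j \<in> {1..i}. j < p j}"
    and "count_list (take i (word_of n p)) Cl = card {j \<in> {1..i}. p j < j}"
    and "count_list (take i (word_of n p)) Fx = card {j \<in> {1..i}. p j = j}"
proof -
  have "{j \<in> {1..i}. word_of n p ! (j - 1) = Op} = {j \<in> {1..i}. j < p j}"
    "{j \<in> {1..i}. word_of n p ! (j - 1) = Cl} = {j \<in> {1..i}. p j < j}"
    "{j \<in> {1..i}. word_of n p ! (j - 1) = Fx} = {j \<in> {1..i}. p j = j}"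
    using assms by (auto simp: nth_word_of split: if_splits)
  then show "count_list (take i (word_of n p)) Op = card {j \<in> {1..i}. j < p j}"
    "count_list (take i (word_of n p)) Cl = card {j \<in> {1..i}. p j < j}"
    "count_list (take i (word_of n p)) Fx = card {j \<in> {1..i}. p j = j}"
    using assms by (simp_all add: count_list_take)
qed

lemma count_word_of_Fx: "count_list (word_of n p) Fx = card (fixed_points n p)"
  using count_word_of(3)[of n n p] by (simp add: fixed_points_def)

lemma image_closers_subset_openers:
  assumes p: "is_involution n p"
  shows "p ` {j \<in> {1..i}. p j < j} \<subseteq> {j \<in> {1..i}. j < p j}"
proof -
  have "1 \<le> p j" if "p j < j" "1 \<le> j" for j
    using that involution_in_iff[OF p, of j] involution_outside[OF p, of j] by (cases "j \<le> n") auto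
  then show ?thesis by (auto simp: involution_involutive[OF p])
qed

text \<open>\<open>p\<close> sends the right ends in the prefix injectively to left ends in it; it
  reaches all of them iff every arc opened in the prefix is closed there, that is, iff the prefix is
  invariant.\<close>

lemma closers_less_openers_iff:
  assumes p: "is_involution n p" and i: "i \<le> n"
  shows "count_list (take i (word_of n p)) Cl < count_list (take i (word_of n p)) Op \<longleftrightarrow>
    p ` {1..i} \<noteq> {1..i}"
proof -
  let ?C = "{j \<in> {1..i}. p j < j}" and ?O = "{j \<in> {1..i}. j < p j}"
  have card_C: "card (p ` ?C) = card ?C"
    by (intro card_image) (simp add: inj_on_def involution_eq_iff[OF p])
  have sub: "p ` ?C \<subseteq> ?O" by (rule image_closers_subset_openers[OF p])
  have "card ?C < card ?O \<longleftrightarrow> p ` ?C \<noteq> ?O"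
    using sub card_C psubset_card_mono[of ?O "p ` ?C"] by auto
  also have "\<dots> \<longleftrightarrow> p ` {1..i} \<noteq> {1..i}"
  proof -
    have "p ` ?C = ?O \<longleftrightarrow> p ` {1..i} = {1..i}"
    proof
      assume eq: "p ` ?C = ?O"
      have "p j \<in> {1..i}" if j: "j \<in> {1..i}" for j
      proof (cases "j < p j")
        case True
        then have "j \<in> p ` ?C" using eq j by auto
        then show ?thesis by (auto simp: involution_involutive[OF p])
      next
        case False
        then show ?thesis using j i involution_in_iff[OF p, of j] by auto
      qed
      then show "p ` {1..i} = {1..i}" by (intro involution_image_eqI[OF p]) auto
    next
      assume eq: "p ` {1..i} = {1..i}"
      have "?O \<subseteq> p ` ?C"
      proof
        fix j assume j: "j \<in> ?O"
        then have "p j \<in> {1..i}" using eq by blast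
        then show "j \<in> p ` ?C"
          using j by (intro image_eqI[of _ _ "p j"]) (auto simp: involution_involutive[OF p])
      qed
      with sub show "p ` ?C = ?O" by blast
    qed
    then show ?thesis by simp
  qed
  finally show ?thesis using i by (simp add: count_word_of)
qed

lemma closers_eq_openers:
  assumes p: "is_involution n p"
  shows "count_list (word_of n p) Cl = count_list (word_of n p) Op"
proof -
  have "{j \<in> {1..n}. j < p j} \<subseteq> p ` {j \<in> {1..n}. p j < j}"
  proof
    fix j assume j: "j \<in> {j \<in> {1..n}. j < p j}"
    then show "j \<in> p ` {j \<in> {1..n}. p j < j}" using involution_in_iff[OF p, of j]
      by (intro image_eqI[of _ _ "p j"]) (auto simp: involution_involutive[OF p])
  qed
  then have "p ` {j \<in> {1..n}. p j < j} = {j \<in> {1..n}. j < p j}"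
    using image_closers_subset_openers[OF p, of n] by blast
  moreover have "card (p ` {j \<in> {1..n}. p j < j}) = card {j \<in> {1..n}. p j < j}"
    by (intro card_image) (simp add: inj_on_def involution_eq_iff[OF p])
  ultimately show ?thesis using count_word_of(1,2)[of n n p] by simp
qed

lemma admissible_word_of_iff:
  assumes p: "is_involution n p" and n: "n \<ge> 2"
  shows "admissible (word_of n p) \<longleftrightarrow>
    (\<forall>i. 0 < i \<and> i < n \<longrightarrow> p ` {1..i} \<noteq> {1..i}) \<and>
    (\<forall>i. 0 < i \<and> i < n \<longrightarrow> p i \<noteq> i \<or> p (Suc i) \<noteq> Suc i)"
proof -
  have "successively (\<lambda>a b. a \<noteq> Fx \<or> b \<noteq> Fx) (word_of n p) \<longleftrightarrow>
      (\<forall>i. Suc i < n \<longrightarrow> p (Suc i) \<noteq> Suc i \<or> p (Suc (Suc i)) \<noteq> Suc (Suc i))"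
    unfolding successively_conv_nth by (auto simp: nth_word_of)
  also have "\<dots> \<longleftrightarrow> (\<forall>i. 0 < i \<and> i < n \<longrightarrow> p i \<noteq> i \<or> p (Suc i) \<noteq> Suc i)"
    by (metis gr0_conv_Suc zero_less_Suc)
  finally show ?thesis
    using n closers_less_openers_iff[OF p] closers_eq_openers[OF p] by (auto simp: admissible_iff)
qed

text \<open>Without nesting, the arcs that open before \<open>i\<close> are those that close before
  \<open>p i\<close>. This is the first-in-first-out rule: the two ends of an arc have equal rank,
  one among the left ends and one among the right ends.\<close>

lemma rank_opener:
  assumes p: "is_involution n p" and nn: "nonnesting p" and i: "i < p i"
  shows "count_list (take (i - 1) (word_of n p)) Op = count_list (take (p i - 1) (word_of n p)) Cl"
proof -
  have i': "i \<in> {1..n}" using involution_outside[OF p, of i] i by auto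
  then have pi: "p i \<in> {1..n}" using involution_in_iff[OF p] by blast
  have range: "p j \<in> {1..n}" if "p j \<noteq> j" for j
    using that involution_outside[OF p, of j] involution_in_iff[OF p, of j] by blast
  have "bij_betw p {j \<in> {1..i - 1}. j < p j} {j \<in> {1..p i - 1}. p j < j}"
  proof (rule bij_betw_byWitness[where f' = p])
    show "p ` {j \<in> {1..i - 1}. j < p j} \<subseteq> {j \<in> {1..p i - 1}. p j < j}"
    proof safe
      fix j assume j: "j \<in> {1..i - 1}" "j < p j"
      then have "1 \<le> j \<and> j \<le> i - 1" by auto
      then have "j < i" by linarith
      then have "p j < p i" using nonnestingD[OF nn _ i] by blast
      then show "p j \<in> {1..p i - 1}" "p (p j) < p j"
        using range[of j] j by (auto simp: involution_involutive[OF p])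
    qed
    show "p ` {j \<in> {1..p i - 1}. p j < j} \<subseteq> {j \<in> {1..i - 1}. j < p j}"
    proof safe
      fix j assume j: "j \<in> {1..p i - 1}" "p j < j"
      have "\<not> i < p j"
        using nonnestingD[OF nn, of i "p j"] j by (auto simp: involution_involutive[OF p])
      moreover have "p j \<noteq> i" using j by (auto simp: involution_involutive[OF p])
      ultimately show "p j \<in> {1..i - 1}" "p j < p (p j)"
        using range[of j] j by (auto simp: involution_involutive[OF p])
    qed
  qed (auto simp: involution_involutive[OF p])
  then have "card {j \<in> {1..i - 1}. j < p j} = card {j \<in> {1..p i - 1}. p j < j}"
    by (rule bij_betw_same_card)
  moreover have "i - 1 \<le> n" "p i - 1 \<le> n" using i' pi by auto
  ultimately show ?thesis by (simp only: count_word_of)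
qed

text \<open>The word shows which positions are left and right ends; the partner of a left end is the
  right end of the same rank, and the images of right ends follow by involutivity.\<close>

lemma word_of_inject:
  assumes p: "is_involution n p" "nonnesting p" and q: "is_involution n q" "nonnesting q"
    and eq: "word_of n p = word_of n q"
  shows "p = q"
proof -
  have same: "(i < p i \<longleftrightarrow> i < q i) \<and> (p i < i \<longleftrightarrow> q i < i)" if "i \<in> {1..n}" for i
  proof -
    have "i - 1 < n" "Suc (i - 1) = i" using that by auto
    then show ?thesis
      using nth_word_of[of "i - 1" n p] nth_word_of[of "i - 1" n q] eq
      by (cases "i < p i"; cases "i < q i"; cases "p i < i"; cases "q i < i") simp_all
  qed
  have opener: "p i = q i" if i: "i \<in> {1..n}" "i < p i" for i
  proof -
    have "i < q i" using same i by blast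
    have range: "p i \<in> {1..n}" "q i \<in> {1..n}"
      using i involution_in_iff[OF p(1)] involution_in_iff[OF q(1)] by blast+
    have "p i - 1 = q i - 1"
    proof (rule rank_inject)
      show "word_of n p ! (p i - 1) = Cl"
        using range i(2) by (simp add: nth_word_of involution_involutive[OF p(1)])
      show "word_of n p ! (q i - 1) = Cl"
        unfolding eq using range \<open>i < q i\<close> by (simp add: nth_word_of involution_involutive[OF q(1)])
      show "count_list (take (p i - 1) (word_of n p)) Cl = count_list (take (q i - 1) (word_of n p)) Cl"
        using rank_opener[OF p i(2)] rank_opener[OF q \<open>i < q i\<close>] eq by simp
    qed (use range in auto)
    then show ?thesis using range by auto
  qed
  have "p i = q i" for i
  proof (cases "i \<in> {1..n}")
    case i: True
    consider "i < p i" | "p i < i" | "p i = i" by linarith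
    then show ?thesis
    proof cases
      case 2
      have "p i \<in> {1..n}" using i involution_in_iff[OF p(1)] by blast
      with 2 opener[of "p i"] have "q (p i) = i" by (simp add: involution_involutive[OF p(1)])
      then show ?thesis by (metis involution_involutive q(1))
    next
      case 3
      then show ?thesis using same[OF i] by (metis nat_neq_iff)
    qed (use opener i in blast)
  qed (simp add: involution_outside[OF p(1)] involution_outside[OF q(1)])
  then show ?thesis by blast
qed

text \<open>Letters of equal rank are partners, so a doubled \<open>Op\<close> and a doubled
  \<open>Cl\<close> of rank \<open>r\<close> are the end points of two arcs with adjacent left ends
  and adjacent right ends.\<close>

lemma ex_parallel_word_of_iff:
  assumes p: "is_involution n p" and nn: "nonnesting p"
  shows "(\<exists>r. parallel r (word_of n p)) \<longleftrightarrow> (\<exists>i. i < p i \<and> p (Suc i) = Suc (p i))"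
proof
  let ?w = "word_of n p"
  assume "\<exists>r. parallel r ?w"
  then obtain r x y where x: "Suc x < n" "?w ! x = Op" "?w ! Suc x = Op" "count_list (take x ?w) Op = r"
    and y: "Suc y < n" "?w ! y = Cl" "?w ! Suc y = Cl" "count_list (take y ?w) Cl = r"
    unfolding parallel_def repeats_iff by auto
  have partner: "p (Suc u) = Suc v"
    if uv: "u < n" "v < n" "?w ! u = Op" "?w ! v = Cl" "count_list (take u ?w) Op = count_list (take v ?w) Cl" for u v
  proof -
    have u: "Suc u < p (Suc u)" using uv by (auto simp: nth_word_of split: if_splits)
    have range: "p (Suc u) \<in> {1..n}" using uv involution_in_iff[OF p, of "Suc u"] by auto
    have "p (Suc u) - 1 = v"
    proof (rule rank_inject)
      show "?w ! (p (Suc u) - 1) = Cl"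
        using range u by (simp add: nth_word_of involution_involutive[OF p])
      show "count_list (take (p (Suc u) - 1) ?w) Cl = count_list (take v ?w) Cl"
        using rank_opener[OF p nn u] uv by simp
    qed (use range uv in auto)
    then show ?thesis using range by auto
  qed
  have "p (Suc x) = Suc y" using x y by (intro partner) auto
  moreover have "p (Suc (Suc x)) = Suc (Suc y)"
    using x y by (intro partner) (auto simp: count_list_take_Suc)
  moreover have "Suc x < p (Suc x)" using x by (auto simp: nth_word_of split: if_splits)
  ultimately show "\<exists>i. i < p i \<and> p (Suc i) = Suc (p i)" by metis
next
  let ?w = "word_of n p"
  assume "\<exists>i. i < p i \<and> p (Suc i) = Suc (p i)"
  then obtain i where i: "i < p i" "p (Suc i) = Suc (p i)" by blast
  have range: "i \<in> {1..n}" "Suc i \<in> {1..n}"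
    using involution_outside[OF p, of i] involution_outside[OF p, of "Suc i"] i by auto
  have range': "p i \<in> {1..n}" "Suc (p i) \<in> {1..n}"
    using range involution_in_iff[OF p] i(2) by metis+
  have pp: "p (p i) = i" "p (Suc (p i)) = Suc i"
    using involution_involutive[OF p, of i] involution_involutive[OF p, of "Suc i"] i(2) by auto
  have "repeats Op (count_list (take (i - 1) ?w) Op) ?w"
    unfolding repeats_iff using range i by (intro exI[of _ "i - 1"]) (simp add: nth_word_of)
  moreover have "repeats Cl (count_list (take (i - 1) ?w) Op) ?w"
    unfolding repeats_iff rank_opener[OF p nn i(1)]
    using range' i pp by (intro exI[of _ "p i - 1"]) (simp add: nth_word_of)
  ultimately show "\<exists>r. parallel r ?w" unfolding parallel_def by blast
qed

text \<open>The \<open>r\<close>-th \<open>Op\<close> is joined to the \<open>r\<close>-th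
  \<open>Cl\<close>, by the increasing enumerations \<open>hA\<close> and \<open>hB\<close> of their
  positions. The prefix condition ensures that the left end comes first, and monotonicity of both
  enumerations excludes nesting.\<close>

lemma ex_involution_of_word:
  assumes prefix: "\<And>i. i \<le> length w \<Longrightarrow> count_list (take i w) Cl \<le> count_list (take i w) Op"
    and balanced: "count_list w Cl = count_list w Op"
  obtains p where "is_involution (length w) p" "nonnesting p" "word_of (length w) p = w"
proof -
  define n where "n = length w"
  define A where "A = {i \<in> {1..n}. w ! (i - 1) = Op}"
  define B where "B = {i \<in> {1..n}. w ! (i - 1) = Cl}"
  define m where "m = card A"
  have card_B: "card B = m"
    using count_list_take[of n w] balanced by (simp add: m_def A_def B_def n_def)
  have disj: "x \<notin> B" if "x \<in> A" for x using that by (simp add: A_def B_def)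
  obtain hA where hA: "bij_betw hA {..<m} A" "strict_mono_on {..<m} hA"
    using ex_bij_betw_strict_mono_card[of A] unfolding m_def by (auto simp: A_def)
  obtain hB where hB: "bij_betw hB {..<m} B" "strict_mono_on {..<m} hB"
    using ex_bij_betw_strict_mono_card[of B] unfolding card_B by (auto simp: B_def)
  have inj: "inj_on hA {..<m}" "inj_on hB {..<m}" and im: "hA ` {..<m} = A" "hB ` {..<m} = B"
    using hA(1) hB(1) by (auto simp: bij_betw_def)
  have mem: "hA r \<in> A" "hB r \<in> B" if "r < m" for r using that im by auto
  define p where "p x = (if x \<in> A then hB (the_inv_into {..<m} hA x)
    else if x \<in> B then hA (the_inv_into {..<m} hB x) else x)" for x
  have pA: "p (hA r) = hB r" if "r < m" for r
    using that mem(1)[OF that] the_inv_into_f_f[OF inj(1)] by (simp add: p_def)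
  have pB: "p (hB r) = hA r" if "r < m" for r
    using that mem(2)[OF that] disj the_inv_into_f_f[OF inj(2)] by (auto simp: p_def)
  have p0: "p x = x" if "x \<notin> A" "x \<notin> B" for x using that by (simp add: p_def)
  have cases: "(\<exists>r<m. x = hA r) \<or> (\<exists>r<m. x = hB r) \<or> x \<notin> A \<and> x \<notin> B" for x
    using im by auto
  have lt: "hA r < hB r" if r: "r < m" for r
  proof (rule ccontr)
    assume "\<not> hA r < hB r"
    moreover have "hA r \<noteq> hB r" using mem[OF r] disj by metis
    ultimately have less: "hB r < hA r" by simp
    \<comment> \<open>Up to \<open>b\<close> there are at least \<open>r + 1\<close> closings, but
      only openings of rank below \<open>r\<close>, hence at most \<open>r\<close>.\<close>
    define b where "b = hB r"
    have b: "b \<le> length w" using mem(2)[OF r] by (simp add: b_def B_def n_def)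
    have "hB ` {..r} \<subseteq> {j \<in> {1..b}. w ! (j - 1) = Cl}"
    proof
      fix y assume "y \<in> hB ` {..r}"
      then obtain s where s: "y = hB s" "s \<le> r" by auto
      then have "y \<le> b" using hB(2) r by (simp add: b_def strict_mono_on_leD)
      then show "y \<in> {j \<in> {1..b}. w ! (j - 1) = Cl}" using mem(2)[of s] s r by (simp add: B_def)
    qed
    then have "card (hB ` {..r}) \<le> card {j \<in> {1..b}. w ! (j - 1) = Cl}" by (intro card_mono) auto
    moreover have "card (hB ` {..r}) = Suc r"
      using inj_on_subset[OF inj(2), of "{..r}"] r by (simp add: card_image subset_eq)
    ultimately have "Suc r \<le> count_list (take b w) Cl" by (simp add: count_list_take[OF b])
    moreover have "{j \<in> {1..b}. w ! (j - 1) = Op} \<subseteq> hA ` {..<r}"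
    proof
      fix y assume y: "y \<in> {j \<in> {1..b}. w ! (j - 1) = Op}"
      then have "y \<in> A" using b by (auto simp: A_def n_def)
      then obtain s where s: "y = hA s" "s < m" using im by auto
      have "\<not> r \<le> s"
      proof
        assume "r \<le> s"
        then have "hA r \<le> hA s" using hA(2) r s(2) by (simp add: strict_mono_on_leD)
        then show False using y s(1) less by (simp add: b_def)
      qed
      then show "y \<in> hA ` {..<r}" using s by auto
    qed
    then have "card {j \<in> {1..b}. w ! (j - 1) = Op} \<le> card (hA ` {..<r})" by (intro card_mono) auto
    then have "count_list (take b w) Op \<le> r"
      using card_image_le[of "{..<r}" hA] by (simp add: count_list_take[OF b])
    ultimately show False using prefix[OF b] by simp
  qed
  have "is_involution n p"
  proof (rule involutionI)
    show "p (p x) = x" for x using cases[of x] pA pB p0 by metis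
    show "p x = x" if "x \<notin> {1..n}" for x using that by (intro p0) (auto simp: A_def B_def)
  qed
  moreover have "nonnesting p"
    unfolding nonnesting_def
  proof (intro allI impI)
    fix a b assume ab: "a < b \<and> b < p b"
    then obtain s where s: "s < m" "b = hA s" using cases[of b] lt pB p0 by (metis less_asym less_irrefl)
    show "p a < p b"
    proof (cases "\<exists>r<m. a = hA r")
      case True
      then obtain r where r: "r < m" "a = hA r" by blast
      have "r < s"
      proof (rule ccontr)
        assume "\<not> r < s"
        then have "hA s \<le> hA r" using hA(2) r s by (simp add: strict_mono_on_leD)
        then show False using ab r s by simp
      qed
      then show ?thesis using strict_mono_onD[OF hB(2), of r s] r s pA by simp
    next
      case False
      then have "p a \<le> a" using cases[of a] lt pB p0 by (metis less_imp_le order_refl)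
      then show ?thesis using ab by simp
    qed
  qed
  moreover have "word_of n p = w"
  proof (rule nth_equalityI)
    fix i assume "i < length (word_of n p)"
    then have i: "i < n" by simp
    show "word_of n p ! i = w ! i"
    proof (cases "w ! i")
      case Op
      then have "Suc i \<in> A" using i by (simp add: A_def)
      then obtain r where r: "r < m" "Suc i = hA r" using im by auto
      then have "Suc i < p (Suc i)" using lt pA by metis
      then show ?thesis using i Op by (simp add: nth_word_of)
    next
      case Cl
      then have "Suc i \<in> B" using i by (simp add: B_def)
      then obtain r where r: "r < m" "Suc i = hB r" using im by auto
      then have "p (Suc i) < Suc i" using lt pB by metis
      then show ?thesis using i Cl by (simp add: nth_word_of)
    next
      case Fx
      then have "p (Suc i) = Suc i" by (intro p0) (auto simp: A_def B_def)
      then show ?thesis using i Fx by (simp add: nth_word_of)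
    qed
  qed (simp add: n_def)
  ultimately show thesis using that by (simp add: n_def)
qed

lemma word_of_eq_321_iff:
  assumes p: "is_involution n p"
  shows "word_of n p = [Op, Fx, Cl] \<longleftrightarrow> n = 3 \<and> p 1 = 3 \<and> p 2 = 2"
proof
  assume eq: "word_of n p = [Op, Fx, Cl]"
  then have "length (word_of n p) = 3" by simp
  then have n: "n = 3" by simp
  have "1 < p 1" using eq nth_word_of[of 0 n p] n by (simp split: if_splits)
  moreover have p2: "p 2 = 2" using eq nth_word_of[of 1 n p] n by (simp add: numeral_2_eq_2 split: if_splits)
  moreover have "p 1 \<noteq> 2" using p2 involution_eq_iff[OF p, of 1 2] by simp
  moreover have "p 1 \<le> 3" using involution_in_iff[OF p, of 1] n by simp
  ultimately show "n = 3 \<and> p 1 = 3 \<and> p 2 = 2" using n by linarith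
next
  assume *: "n = 3 \<and> p 1 = 3 \<and> p 2 = 2"
  then have "p 3 = 1" using involution_involutive[OF p, of 1] by simp
  moreover have "[1..<Suc 3] = [1, 2, 3]" by (simp add: upt_rec)
  ultimately show "word_of n p = [Op, Fx, Cl]" using * by (simp add: word_of_def del: upt_Suc)
qed

section \<open>Reduced words and the number of simple involutions\<close>

definition reduced_words :: "nat \<Rightarrow> nat \<Rightarrow> step list set" where
  "reduced_words j k = {w. admissible w \<and> count_list w Op + count_list w Cl = j \<and>
     count_list w Fx = k \<and> (\<forall>i. \<not> parallel i w)}"

text \<open>Openings and closings are equinumerous, so \<open>j\<close> is even with
  \<open>j div 2\<close> arcs, and no parallel pair has an index of \<open>j div 2\<close> or
  more.\<close>

lemma reduced_words_eq: "reduced_words j k = (if even j then words (j div 2) (j div 2) k else {})"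
proof -
  have "(\<forall>i. \<not> parallel i w) \<longleftrightarrow> (\<forall>i<count_list w Op. \<not> parallel i w)" for w
    unfolding parallel_def by (meson Suc_lessD repeats_imp_less_count)
  then show ?thesis
    by (auto simp: reduced_words_def words_def admissible_counts)
qed

lemma admissible_prefix:
  assumes "admissible w" "i \<le> length w"
  shows "count_list (take i w) Cl \<le> count_list (take i w) Op"
proof (cases "i = 0 \<or> i = length w")
  case True
  then show ?thesis using admissible_counts[OF assms(1)] by auto
next
  case False
  then have "2 \<le> length w" using assms(2) by linarith
  then show ?thesis using admissible_iff[of w] assms False by (simp add: less_imp_le)
qed

lemma word_of_image:
  assumes n: "j + k \<ge> 3"
  shows "word_of (j + k) ` {p. is_involution (j + k) p \<and> simple_perm (j + k) p \<and>
      avoids_pattern (j + k) p [4, 3, 2, 1] \<and> card (fixed_points (j + k) p) = k} =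
    reduced_words j k - {[Op, Fx, Cl]}" (is "word_of ?n ` ?S = _")
proof -
  have iff: "p \<in> ?S \<longleftrightarrow> word_of ?n p \<in> reduced_words j k - {[Op, Fx, Cl]}"
    if p: "is_involution ?n p" and nn: "nonnesting p" for p
  proof -
    have "?n \<ge> 2" using n by simp
    have "p \<in> ?S \<longleftrightarrow> admissible (word_of ?n p) \<and> \<not> (\<exists>r. parallel r (word_of ?n p)) \<and>
        word_of ?n p \<noteq> [Op, Fx, Cl] \<and> count_list (word_of ?n p) Fx = k"
      unfolding mem_Collect_eq simple_perm_iff[OF p nn n] admissible_word_of_iff[OF p \<open>?n \<ge> 2\<close>]
        ex_parallel_word_of_iff[OF p nn] word_of_eq_321_iff[OF p] count_word_of_Fx
        avoids_4321_iff_nonnesting[OF p]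
      using p nn by blast
    also have "\<dots> \<longleftrightarrow> word_of ?n p \<in> reduced_words j k - {[Op, Fx, Cl]}"
      using length_step_list[of "word_of ?n p"] by (auto simp: reduced_words_def)
    finally show ?thesis .
  qed
  show ?thesis
  proof (intro equalityI subsetI)
    fix w assume "w \<in> word_of ?n ` ?S"
    then obtain p where p: "p \<in> ?S" "w = word_of ?n p" by blast
    then have "is_involution ?n p" "avoids_pattern ?n p [4, 3, 2, 1]" by blast+
    then have "p \<in> ?S \<longleftrightarrow> w \<in> reduced_words j k - {[Op, Fx, Cl]}"
      using iff[of p] avoids_4321_iff_nonnesting[of ?n p] unfolding p(2) by blast
    with p(1) show "w \<in> reduced_words j k - {[Op, Fx, Cl]}" by blast
  next
    fix w assume w: "w \<in> reduced_words j k - {[Op, Fx, Cl]}"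
    then have "admissible w" "length w = ?n"
      by (auto simp: reduced_words_def length_step_list)
    then obtain p where "is_involution ?n p" "nonnesting p" "word_of ?n p = w"
      using ex_involution_of_word[of w] admissible_prefix admissible_counts by metis
    with iff[of p] w show "w \<in> word_of ?n ` ?S" by blast
  qed
qed

lemma word_321_in_reduced_words_iff: "[Op, Fx, Cl] \<in> reduced_words j k \<longleftrightarrow> j = 2 \<and> k = 1"
proof -
  have "\<not> parallel i [Op, Fx, Cl]" for i
    by (simp add: parallel_def split: nat.splits)
  then show ?thesis by (auto simp: reduced_words_def)
qed

lemma reduced_words_short:
  assumes "j + k < 3"
  shows "reduced_words j k = (if j = 2 then {[Op, Cl]} else {})"
proof -
  have "w = [Op, Cl] \<and> j = 2" if w: "w \<in> reduced_words j k" for w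
  proof -
    have len: "length w < 3" and adm: "admissible w"
      using w assms by (auto simp: reduced_words_def length_step_list)
    from adm obtain v where v: "w = Op # v" "good 1 v" by (cases w rule: admissible.cases) auto
    then obtain y u where "v = y # u" by (cases v) auto
    with len v have "w = [Op, Cl]" by (cases y) auto
    then show ?thesis using w by (simp add: reduced_words_def)
  qed
  moreover have "[Op, Cl] \<in> reduced_words j k" if "j = 2"
  proof -
    have "\<not> parallel i [Op, Cl]" for i by (simp add: parallel_def split: nat.splits)
    then show ?thesis using that assms by (simp add: reduced_words_def)
  qed
  ultimately show ?thesis by auto
qed

text \<open>The added term restores the word of 321 for \<open>j + k = 3\<close> and, for
  \<open>j + k = 2\<close>, that of 21, which \<open>g\<close> does not count.\<close>

lemma card_reduced_words: "g j k + (if j = 2 \<and> k \<le> 1 then 1 else 0) = card (reduced_words j k)"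
proof (cases "j + k \<ge> 3")
  case True
  let ?S = "{p. is_involution (j + k) p \<and> simple_perm (j + k) p \<and>
      avoids_pattern (j + k) p [4, 3, 2, 1] \<and> card (fixed_points (j + k) p) = k}"
  have "inj_on (word_of (j + k)) ?S"
    by (rule inj_onI) (use avoids_4321_iff_nonnesting word_of_inject in blast)
  then have "g j k = card (reduced_words j k - {[Op, Fx, Cl]})"
    using True by (simp add: g_def card_image flip: word_of_image[OF True])
  moreover have "finite (reduced_words j k)" by (simp add: reduced_words_eq finite_words)
  ultimately show ?thesis using True word_321_in_reduced_words_iff[of j k] card_Suc_Diff1[of "reduced_words j k" "[Op, Fx, Cl]"]
    by (cases "j = 2 \<and> k = 1") auto
next
  case False
  then show ?thesis using reduced_words_short[of j k] by (auto simp: g_def)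
qed

theorem theorem3p3:
  shows "\<exists>s. is_fps_sqrt (- 4 + 4 * inverse (1 + X ^ 2) + inverse ((1 + Y) ^ 2))
               (inverse (1 + fps_X)) s \<and>
             \<gamma> = half * (inverse (1 + Y) - 2 * X ^ 2 * (1 + Y) - s)"
proof (rule gamma_closed_form)
  fix j k
  have "g j k + (if j = 2 \<and> k \<le> 1 then 1 else 0) = card (reduced_words j k)"
    by (rule card_reduced_words)
  also have "\<dots> = (if even j then card (words (j div 2) (j div 2) k) else 0)"
    by (simp add: reduced_words_eq)
  finally show "g j k + (if j = 2 \<and> k \<le> 1 then 1 else 0) =
      (if even j then card (words (j div 2) (j div 2) k) else 0)" .
qed

end
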